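(* Let $\mu>0$ and let $(c_j)_{j\ge0}$ be a sequence of positive numbers. For an integer $N\ge2$ let $\gamma$ denote the degree of the $(\mu,(c_j),N)$-random walk on $\Omega_N$, and put $$\overline c=\limsup_{j\to\infty}\frac{c_{j+1}}{c_j},\qquad\underline c=\liminf_{j\to\infty}\frac{c_{j+1}}{c_j}.$$ (1) If $\overline c<N^{1/\mu}$, then $$\gamma\le\frac{\mu-1+\mu\log\overline c/\log N}{1-\mu\log\overline c/\log N}.$$ (2) If $\underline c<N^{1/\mu}$, then $$\gamma\ge\frac{\mu-1+\mu\log\underline c/\log N}{1-\mu\log\underline c/\log N}.$$ (3) If $0<\underline c\le\overline c<\infty$, then $\gamma=\mu-1+O(1/\log N)$ as $N\to\infty$ (with $\mu$ and $(c_j)$ fixed).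
   Context: $\Omega_N=\{x=(x_1,x_2,\dots): x_i\in\mathbb Z_N,\ x_i\ne0 \text{ for only finitely many } i\}$ with $\mathbb Z_N$ the cyclic group of order $N$ and componentwise addition mod $N$; $|x|=\max\{i:x_i\ne0\}$ for $x\neq 0$ and $|0|=0$. Given a probability distribution $(r_j)_{j\ge1}$ on $\{1,2,\dots\}$ with all $r_j>0$, the $r_j$-random walk on $\Omega_N$ has i.i.d. steps $\eta$ with $\mathbb P[\eta=y]=\frac{r_{|y|}}{N^{|y|-1}(N-1)}$ for $y\neq0$ and $\mathbb P[\eta=0]=0$; its continuous-time version has unit-rate exponential holding times and transition probability $p_t(x,y)$. When $\sum_j c_jN^{-j/\mu}<\infty$ (which is assumed whenever the walk is considered), the $(\mu,(c_j),N)$-random walk is the (continuous-time) $r_j$-random walk with $r_j=D\,c_{j-1}N^{-(j-1)/\mu}$, $j\ge1$, $D$ being the normalizing constant. With $G^{\zeta}\varphi=\frac1{\Gamma(\zeta)}\int_0^\infty t^{\zeta-1}T_t\varphi\,dt$ ($\zeta>0$, $T_t$ the semigroup), the degree is $\gamma=\sup\{\zeta>-1:G^{\zeta+1}\varphi<\infty$ for all finitely supported $\varphi\ge0\}$; by irreducibility $G^{\zeta+1}\varphi<\infty$ for all such $\varphi$ iff $\int_0^\infty t^{\zeta}p_t(0,0)\,dt<\infty$. Conventions: $\sup\emptyset=-1$, and the fractions in (1), (2) are read as their limit $-1$ when $\overline c=0$, respectively $\underline c=0$. *)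

theory Defs
  imports
    "HOL-Algebra.FiniteProduct"
    "HOL-Algebra.Product_Groups"
    "HOL-Algebra.Elementary_Groups"
    "HOL-Probability.Probability"
    "HOL-Library.Landau_Symbols"
begin

section \<open>The hierarchical group and its norm\<close>

text \<open>Elements are functions on the positive integers with values in \<open>{0..<N}\<close>, finitely many of
  which are nonzero; as usual for \<open>sum_group\<close>, they are \<open>undefined\<close> at the irrelevant index \<open>0\<close>.\<close>

definition hgroup :: "nat \<Rightarrow> (nat \<Rightarrow> int) monoid" where
  "hgroup N = sum_group {1..} (\<lambda>_. integer_mod_group N)"

definition hnorm :: "nat \<Rightarrow> (nat \<Rightarrow> int) \<Rightarrow> nat" where
  "hnorm N x = (if x = \<one>\<^bsub>hgroup N\<^esub> then 0 else Max {i. 1 \<le> i \<and> x i \<noteq> 0})"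


section \<open>The random walk with jump weights \<open>r j\<close>, \<open>j \<ge> 1\<close>\<close>

text \<open>The value \<open>r 0\<close> is never used.\<close>

definition step_prob :: "nat \<Rightarrow> (nat \<Rightarrow> real) \<Rightarrow> (nat \<Rightarrow> int) \<Rightarrow> real" where
  "step_prob N r y =
    (if y = \<one>\<^bsub>hgroup N\<^esub> then 0
     else r (hnorm N y) / (real N ^ (hnorm N y - 1) * (real N - 1)))"

text \<open>The law of a step lives on the countable discrete space \<open>carrier (hgroup N)\<close> and not on the
  uncountable type \<open>nat \<Rightarrow> int\<close>; this keeps group operations measurable for product
  \<open>\<sigma>\<close>-algebras.\<close>

definition step_dist :: "nat \<Rightarrow> (nat \<Rightarrow> real) \<Rightarrow> (nat \<Rightarrow> int) measure" where
  "step_dist N r = point_measure (carrier (hgroup N)) (\<lambda>y. ennreal (step_prob N r y))"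

text \<open>Sample space: a sequence of i.i.d. steps together with an independent sequence of i.i.d.
  exponential holding times of rate one.\<close>

definition walk_space :: "nat \<Rightarrow> (nat \<Rightarrow> real) \<Rightarrow> ((nat \<Rightarrow> nat \<Rightarrow> int) \<times> (nat \<Rightarrow> real)) measure" where
  "walk_space N r =
    (\<Pi>\<^sub>M n\<in>UNIV. step_dist N r) \<Otimes>\<^sub>M (\<Pi>\<^sub>M n\<in>UNIV. density lborel (exponential_density 1))"

text \<open>The \<open>n\<close>-th jump (counted from \<open>0\<close>) happens at time \<open>\<Sum>i\<le>n. \<xi> i\<close>. Almost surely the set of
  \<open>n\<close> below is nonempty, and its least element is the number of jumps up to time \<open>t\<close>.\<close>

definition num_jumps :: "(nat \<Rightarrow> real) \<Rightarrow> real \<Rightarrow> nat" where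
  "num_jumps \<xi> t = (LEAST n. t < (\<Sum>i\<le>n. \<xi> i))"

definition walk_pos ::
    "nat \<Rightarrow> (nat \<Rightarrow> int) \<Rightarrow> real \<Rightarrow> (nat \<Rightarrow> nat \<Rightarrow> int) \<times> (nat \<Rightarrow> real) \<Rightarrow> nat \<Rightarrow> int" where
  "walk_pos N x t \<omega> =
    x \<otimes>\<^bsub>hgroup N\<^esub> finprod (hgroup N) (fst \<omega>) {..<num_jumps (snd \<omega>) t}"

definition trans_prob ::
    "nat \<Rightarrow> (nat \<Rightarrow> real) \<Rightarrow> real \<Rightarrow> (nat \<Rightarrow> int) \<Rightarrow> (nat \<Rightarrow> int) \<Rightarrow> real" where
  "trans_prob N r t x y =
    measure (walk_space N r) {\<omega> \<in> space (walk_space N r). walk_pos N x t \<omega> = y}"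


section \<open>Semigroup, fractional potentials and degree\<close>

definition semigroup_op ::
    "nat \<Rightarrow> (nat \<Rightarrow> real) \<Rightarrow> real \<Rightarrow> ((nat \<Rightarrow> int) \<Rightarrow> real) \<Rightarrow> (nat \<Rightarrow> int) \<Rightarrow> real" where
  "semigroup_op N r t \<phi> x = (\<Sum>\<^sub>\<infinity>y\<in>carrier (hgroup N). trans_prob N r t x y * \<phi> y)"

text \<open>Only used for \<open>\<zeta> > 0\<close> and \<open>\<phi> \<ge> 0\<close>; the value lies in \<open>[0, \<infinity>]\<close>.\<close>

definition frac_potential ::
    "nat \<Rightarrow> (nat \<Rightarrow> real) \<Rightarrow> real \<Rightarrow> ((nat \<Rightarrow> int) \<Rightarrow> real) \<Rightarrow> (nat \<Rightarrow> int) \<Rightarrow> ennreal" where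
  "frac_potential N r \<zeta> \<phi> x =
    ennreal (1 / Gamma \<zeta>) *
    (\<integral>\<^sup>+t\<in>{0<..}. ennreal (t powr (\<zeta> - 1) * semigroup_op N r t \<phi> x) \<partial>lborel)"

definition potential_finite :: "nat \<Rightarrow> (nat \<Rightarrow> real) \<Rightarrow> real \<Rightarrow> bool" where
  "potential_finite N r \<zeta> \<longleftrightarrow>
    (\<forall>\<phi>. (\<forall>y\<in>carrier (hgroup N). 0 \<le> \<phi> y) \<and> finite {y \<in> carrier (hgroup N). \<phi> y \<noteq> 0} \<longrightarrow>
      (\<forall>x\<in>carrier (hgroup N). frac_potential N r \<zeta> \<phi> x < \<infinity>))"

text \<open>Inserting \<open>-1\<close> implements the convention that the supremum of the empty set is \<open>-1\<close>.\<close>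

definition walk_degree :: "nat \<Rightarrow> (nat \<Rightarrow> real) \<Rightarrow> ereal" where
  "walk_degree N r =
    Sup (insert (-1) (ereal ` {\<zeta>. \<zeta> > -1 \<and> potential_finite N r (\<zeta> + 1)}))"


section \<open>The walk with parameters \<open>\<mu>\<close>, \<open>c\<close>, \<open>N\<close>\<close>

definition raw_weight :: "real \<Rightarrow> (nat \<Rightarrow> real) \<Rightarrow> nat \<Rightarrow> nat \<Rightarrow> real" where
  "raw_weight \<mu> c N j = c j * real N powr (- real j / \<mu>)"

definition jump_weight :: "real \<Rightarrow> (nat \<Rightarrow> real) \<Rightarrow> nat \<Rightarrow> nat \<Rightarrow> real" where
  "jump_weight \<mu> c N j = raw_weight \<mu> c N (j - 1) / (\<Sum>k. raw_weight \<mu> c N k)"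

definition rw_degree :: "real \<Rightarrow> (nat \<Rightarrow> real) \<Rightarrow> nat \<Rightarrow> ereal" where
  "rw_degree \<mu> c N = walk_degree N (jump_weight \<mu> c N)"

text \<open>The case \<open>a = 0\<close> is the limit as \<open>a\<close> tends to \<open>0\<close> from the right (and is needed because
  \<open>ln 0 = 0\<close> here).\<close>

definition degree_bound :: "real \<Rightarrow> nat \<Rightarrow> real \<Rightarrow> real" where
  "degree_bound \<mu> N a =
    (if a = 0 then -1
     else (\<mu> - 1 + \<mu> * ln a / ln (real N)) / (1 - \<mu> * ln a / ln (real N)))"


section \<open>Well-definedness\<close>

lemma carrier_hgroup:
  assumes "N > 0"
  shows "carrier (hgroup N) =
    {x \<in> {1..} \<rightarrow>\<^sub>E {0..<int N}. finite {i. 1 \<le> i \<and> x i \<noteq> 0}}"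
  using assms by (auto simp: hgroup_def carrier_sum_group carrier_integer_mod_group)

lemma one_hgroup: "\<one>\<^bsub>hgroup N\<^esub> = (\<lambda>i\<in>{1..}. 0)"
  by (simp add: hgroup_def)

lemma mult_hgroup: "x \<otimes>\<^bsub>hgroup N\<^esub> y = (\<lambda>i\<in>{1..}. (x i + y i) mod int N)"
  by (simp add: hgroup_def)

lemma comm_group_hgroup: "comm_group (hgroup N)"
proof -
  have "group (hgroup N)"
    unfolding hgroup_def by simp
  then show ?thesis
    by (rule group.group_comm_groupI) (simp add: mult_hgroup add.commute)
qed

lemma hnorm_eq_0_iff:
  assumes "N > 0" "x \<in> carrier (hgroup N)"
  shows "hnorm N x = 0 \<longleftrightarrow> x = \<one>\<^bsub>hgroup N\<^esub>"
proof
  assume *: "hnorm N x = 0"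
  show "x = \<one>\<^bsub>hgroup N\<^esub>"
  proof (rule ccontr)
    assume ne: "x \<noteq> \<one>\<^bsub>hgroup N\<^esub>"
    have ext: "x i = undefined" if "\<not> 1 \<le> i" for i
      using assms that by (auto simp: carrier_hgroup PiE_def extensional_def)
    have "{i. 1 \<le> i \<and> x i \<noteq> 0} \<noteq> {}"
    proof
      assume e: "{i. 1 \<le> i \<and> x i \<noteq> 0} = {}"
      have "x = \<one>\<^bsub>hgroup N\<^esub>"
        using e ext by (auto simp: one_hgroup restrict_def fun_eq_iff)
      with ne show False by simp
    qed
    moreover have "finite {i. 1 \<le> i \<and> x i \<noteq> 0}"
      using assms by (simp add: carrier_hgroup)
    ultimately have "Max {i. 1 \<le> i \<and> x i \<noteq> 0} \<in> {i. 1 \<le> i \<and> x i \<noteq> 0}"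
      by (intro Max_in)
    then show False
      using * ne by (simp add: hnorm_def)
  qed
qed (simp add: hnorm_def)

definition hball :: "nat \<Rightarrow> nat \<Rightarrow> (nat \<Rightarrow> int) set" where
  "hball N k = {x \<in> carrier (hgroup N). hnorm N x \<le> k}"

lemma hball_alt:
  assumes "N > 0"
  shows "hball N k = {x \<in> carrier (hgroup N). \<forall>i>k. x i = 0}"
proof (intro Set.set_eqI iffI)
  fix x assume x: "x \<in> hball N k"
  then have c: "x \<in> carrier (hgroup N)" and n: "hnorm N x \<le> k"
    by (auto simp: hball_def)
  have "x i = 0" if "i > k" for i
  proof (rule ccontr)
    assume nz: "x i \<noteq> 0"
    have "x \<noteq> \<one>\<^bsub>hgroup N\<^esub>"
      using nz that by (auto simp: one_hgroup)
    moreover have "i \<le> Max {i. 1 \<le> i \<and> x i \<noteq> 0}"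
      using c assms nz that by (intro Max_ge) (auto simp: carrier_hgroup)
    ultimately show False
      using n that by (simp add: hnorm_def)
  qed
  with c show "x \<in> {x \<in> carrier (hgroup N). \<forall>i>k. x i = 0}" by auto
next
  fix x assume x: "x \<in> {x \<in> carrier (hgroup N). \<forall>i>k. x i = 0}"
  then have c: "x \<in> carrier (hgroup N)" and z: "\<And>i. i > k \<Longrightarrow> x i = 0" by auto
  have "hnorm N x \<le> k"
  proof (cases "x = \<one>\<^bsub>hgroup N\<^esub>")
    case False
    let ?S = "{i. 1 \<le> i \<and> x i \<noteq> 0}"
    have fin: "finite ?S"
      using c assms by (simp add: carrier_hgroup)
    have "hnorm N x \<noteq> 0"
      using hnorm_eq_0_iff[OF assms c] False by simp
    have ne: "?S \<noteq> {}"
    proof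
      assume e: "?S = {}"
      have "x i = undefined" if "\<not> 1 \<le> i" for i
        using assms c that by (auto simp: carrier_hgroup PiE_def extensional_def)
      with e have "x = \<one>\<^bsub>hgroup N\<^esub>"
        by (auto simp: one_hgroup restrict_def fun_eq_iff)
      with False show False by simp
    qed
    have "Max ?S \<in> ?S"
      using fin ne by (rule Max_in)
    then have "\<not> Max ?S > k" using z by auto
    then show ?thesis using False by (simp add: hnorm_def)
  qed (simp add: hnorm_def)
  with c show "x \<in> hball N k" by (simp add: hball_def)
qed

lemma finite_card_hball:
  assumes "N > 0"
  shows "finite (hball N k)" "card (hball N k) = N ^ k"
proof -
  let ?P = "{1..k} \<rightarrow>\<^sub>E {0..<int N}"
  let ?f = "\<lambda>x. restrict x {1..k}"
  let ?g = "\<lambda>x i. if i > k then 0 else x i"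
  have bij: "bij_betw ?f (hball N k) ?P"
  proof (rule bij_betw_byWitness[where f' = ?g])
    show "\<forall>a\<in>hball N k. ?g (?f a) = a"
    proof
      fix a assume a: "a \<in> hball N k"
      then have z: "\<And>i. i > k \<Longrightarrow> a i = 0" and u: "\<And>i. \<not> 1 \<le> i \<Longrightarrow> a i = undefined"
        using assms by (auto simp: hball_alt carrier_hgroup PiE_def extensional_def)
      show "?g (?f a) = a"
      proof
        fix i show "?g (?f a) i = a i"
          using z[of i] u[of i] by (cases "1 \<le> i") auto
      qed
    qed
    show "\<forall>b\<in>?P. ?f (?g b) = b"
      by (auto simp: fun_eq_iff restrict_def PiE_def extensional_def)
    show "?f ` hball N k \<subseteq> ?P"
      using assms by (auto simp: hball_alt carrier_hgroup PiE_iff)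
    show "?g ` ?P \<subseteq> hball N k"
    proof
      fix x assume "x \<in> ?g ` ?P"
      then obtain b where b: "b \<in> ?P" "x = ?g b" by auto
      have "finite {i. 1 \<le> i \<and> x i \<noteq> 0}"
        by (rule finite_subset[of _ "{1..k}"]) (auto simp: b(2) split: if_splits)
      moreover have "x \<in> {1..} \<rightarrow>\<^sub>E {0..<int N}"
        using b assms by (auto simp: PiE_iff extensional_def)
      ultimately show "x \<in> hball N k"
        using assms b by (auto simp: hball_alt carrier_hgroup)
    qed
  qed
  have "finite ?P" by (intro finite_PiE) auto
  then show "finite (hball N k)"
    using bij_betw_finite[OF bij] by simp
  show "card (hball N k) = N ^ k"
    using bij_betw_same_card[OF bij] by (simp add: card_PiE)
qed

lemma carrier_hgroup_eq_UN_hball: "carrier (hgroup N) = (\<Union>k. hball N k)"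
  by (auto simp: hball_def)

lemma countable_carrier_hgroup:
  assumes "N > 0"
  shows "countable (carrier (hgroup N))"
  unfolding carrier_hgroup_eq_UN_hball
  by (rule countable_UN) (auto intro: countable_finite finite_card_hball(1)[OF assms])

lemma card_hsphere:
  assumes "N > 0"
  shows "finite {x \<in> carrier (hgroup N). hnorm N x = Suc k}"
    and "card {x \<in> carrier (hgroup N). hnorm N x = Suc k} = N ^ k * (N - 1)"
proof -
  have eq: "{x \<in> carrier (hgroup N). hnorm N x = Suc k} = hball N (Suc k) - hball N k"
    by (auto simp: hball_def)
  show "finite {x \<in> carrier (hgroup N). hnorm N x = Suc k}"
    unfolding eq using finite_card_hball(1)[OF assms] by simp
  have "card (hball N (Suc k) - hball N k) = N ^ Suc k - N ^ k"
    using finite_card_hball[OF assms] by (subst card_Diff_subset) (auto simp: hball_def)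
  also have "\<dots> = N ^ k * (N - 1)"
    by (simp add: algebra_simps diff_mult_distrib2)
  finally show "card {x \<in> carrier (hgroup N). hnorm N x = Suc k} = N ^ k * (N - 1)"
    by (simp add: eq)
qed

lemma emeasure_step_dist_sphere:
  assumes "N \<ge> 2"
  shows "emeasure (step_dist N r) {x \<in> carrier (hgroup N). hnorm N x = Suc k} = ennreal (r (Suc k))"
proof -
  let ?S = "{x \<in> carrier (hgroup N). hnorm N x = Suc k}"
  let ?q = "r (Suc k) / (real N ^ k * (real N - 1))"
  have N: "N > 0" using assms by simp
  have ne: "x \<noteq> \<one>\<^bsub>hgroup N\<^esub>" if "x \<in> ?S" for x
    using that by (auto simp: hnorm_def)
  have "emeasure (step_dist N r) ?S =
      (\<integral>\<^sup>+x. ennreal (step_prob N r x) * indicator ?S x \<partial>count_space (carrier (hgroup N)))"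
    unfolding step_dist_def point_measure_def by (subst emeasure_density) auto
  also have "\<dots> = (\<integral>\<^sup>+x. ennreal ?q * indicator ?S x \<partial>count_space (carrier (hgroup N)))"
    using ne by (intro nn_integral_cong) (auto simp: step_prob_def split: split_indicator)
  also have "\<dots> = ennreal ?q * of_nat (card ?S)"
    using card_hsphere(1)[OF N, of k]
    by (subst nn_integral_cmult_indicator) (auto simp: emeasure_count_space)
  also have "\<dots> = ennreal (?q * real (card ?S))"
    by (subst ennreal_mult'') (simp_all add: ennreal_of_nat_eq_real_of_nat)
  also have "?q * real (card ?S) = r (Suc k)"
    using assms by (simp add: card_hsphere(2)[OF N] of_nat_diff)
  finally show ?thesis .
qed

lemma prob_space_step_dist:
  assumes "N \<ge> 2" "\<And>j. 0 \<le> r (Suc j)" "(\<lambda>j. r (Suc j)) sums 1"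
  shows "prob_space (step_dist N r)"
proof
  let ?S = "\<lambda>k. {x \<in> carrier (hgroup N). hnorm N x = Suc k}"
  let ?M = "step_dist N r"
  have N: "N > 0" using assms by simp
  have sets: "sets ?M = Pow (carrier (hgroup N))"
    by (simp add: step_dist_def sets_point_measure)
  have one: "\<one>\<^bsub>hgroup N\<^esub> \<in> carrier (hgroup N)"
    using comm_group_hgroup[of N] by (simp add: comm_group_def group_def)
  have space: "space ?M = {\<one>\<^bsub>hgroup N\<^esub>} \<union> (\<Union>k. ?S k)"
    using hnorm_eq_0_iff[OF N] one
    by (auto simp: step_dist_def space_point_measure) (metis not0_implies_Suc)
  have dj: "{\<one>\<^bsub>hgroup N\<^esub>} \<inter> (\<Union>k. ?S k) = {}"
    by (auto simp: hnorm_def)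
  have "emeasure ?M {\<one>\<^bsub>hgroup N\<^esub>} =
      (\<integral>\<^sup>+x. ennreal (step_prob N r x) * indicator {\<one>\<^bsub>hgroup N\<^esub>} x
         \<partial>count_space (carrier (hgroup N)))"
    unfolding step_dist_def point_measure_def using one by (subst emeasure_density) auto
  also have "\<dots> = (\<integral>\<^sup>+x. 0 \<partial>count_space (carrier (hgroup N)))"
    by (intro nn_integral_cong) (auto simp: step_prob_def split: split_indicator)
  finally have z: "emeasure ?M {\<one>\<^bsub>hgroup N\<^esub>} = 0" by simp
  have "emeasure ?M (\<Union>k. ?S k) = (\<Sum>k. emeasure ?M (?S k))"
    by (rule suminf_emeasure[symmetric]) (auto simp: sets disjoint_family_on_def)
  also have "\<dots> = (\<Sum>k. ennreal (r (Suc k)))"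
    by (simp add: emeasure_step_dist_sphere[OF assms(1)])
  also have "\<dots> = 1"
    using assms(2,3) by (subst suminf_ennreal_eq[of _ 1]) auto
  finally have u: "emeasure ?M (\<Union>k. ?S k) = 1" .
  have "emeasure ?M ({\<one>\<^bsub>hgroup N\<^esub>} \<union> (\<Union>k. ?S k)) = 0 + 1"
    using one dj by (subst plus_emeasure[symmetric]) (auto simp: sets z u)
  then show "emeasure ?M (space ?M) = 1"
    unfolding space by simp
qed

lemma jump_weight_sums:
  assumes "\<And>j. c j > 0" "N \<ge> 2" "summable (raw_weight \<mu> c N)"
  shows "jump_weight \<mu> c N (Suc j) > 0" "(\<lambda>j. jump_weight \<mu> c N (Suc j)) sums 1"
proof -
  have p: "raw_weight \<mu> c N k > 0" for k
    using assms by (simp add: raw_weight_def)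
  then have s: "(\<Sum>k. raw_weight \<mu> c N k) > 0"
    using assms(3) by (intro suminf_pos) auto
  show "jump_weight \<mu> c N (Suc j) > 0"
    using p s by (simp add: jump_weight_def)
  show "(\<lambda>j. jump_weight \<mu> c N (Suc j)) sums 1"
    using sums_divide[OF summable_sums[OF assms(3)], of "\<Sum>k. raw_weight \<mu> c N k"] s
    by (simp add: jump_weight_def)
qed

lemma prob_space_walk_space:
  assumes "N \<ge> 2" "\<And>j. 0 \<le> r (Suc j)" "(\<lambda>j. r (Suc j)) sums 1"
  shows "prob_space (walk_space N r)"
proof -
  interpret A: prob_space "\<Pi>\<^sub>M n\<in>(UNIV::nat set). step_dist N r"
    using prob_space_step_dist[OF assms] by (intro prob_space_PiM) auto
  interpret B: prob_space "\<Pi>\<^sub>M n\<in>(UNIV::nat set). density lborel (exponential_density 1)"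
    by (intro prob_space_PiM prob_space_exponential_density) simp
  interpret pair_prob_space "\<Pi>\<^sub>M n\<in>(UNIV::nat set). step_dist N r"
    "\<Pi>\<^sub>M n\<in>(UNIV::nat set). density lborel (exponential_density 1)" ..
  show ?thesis
    unfolding walk_space_def by (rule prob_space_axioms)
qed

lemma num_jumps_measurable:
  "(\<lambda>\<xi>. num_jumps \<xi> t) \<in>
    (\<Pi>\<^sub>M n\<in>(UNIV::nat set). density lborel (exponential_density 1)) \<rightarrow>\<^sub>M count_space UNIV"
  unfolding num_jumps_def by measurable

lemma walk_pos_measurable:
  assumes "N > 0" "x \<in> carrier (hgroup N)"
  shows "walk_pos N x t \<in> walk_space N r \<rightarrow>\<^sub>M count_space (carrier (hgroup N))"
proof -
  let ?G = "hgroup N" and ?C = "count_space (carrier (hgroup N))"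
  interpret G: comm_group ?G by (rule comm_group_hgroup)
  have cnt: "countable (carrier ?G)"
    using assms(1) by (rule countable_carrier_hgroup)
  have mult: "(\<lambda>\<omega>. f \<omega> \<otimes>\<^bsub>?G\<^esub> g \<omega>) \<in> walk_space N r \<rightarrow>\<^sub>M ?C"
    if f: "f \<in> walk_space N r \<rightarrow>\<^sub>M ?C" and g: "g \<in> walk_space N r \<rightarrow>\<^sub>M ?C" for f g
  proof -
    have "(\<lambda>\<omega>. (\<lambda>a \<omega>. a \<otimes>\<^bsub>?G\<^esub> g \<omega>) (f \<omega>) \<omega>) \<in> walk_space N r \<rightarrow>\<^sub>M ?C"
    proof (rule measurable_compose_countable'[OF _ f cnt])
      fix a assume "a \<in> carrier ?G"
      then have "(\<lambda>b. a \<otimes>\<^bsub>?G\<^esub> b) \<in> ?C \<rightarrow>\<^sub>M ?C"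
        by simp
      then show "(\<lambda>\<omega>. a \<otimes>\<^bsub>?G\<^esub> g \<omega>) \<in> walk_space N r \<rightarrow>\<^sub>M ?C"
        by (rule measurable_compose[OF g])
    qed
    then show ?thesis by simp
  qed
  have sC: "sets (step_dist N r) = sets ?C"
    by (simp add: step_dist_def sets_point_measure)
  have fst_meas: "fst \<in> walk_space N r \<rightarrow>\<^sub>M (\<Pi>\<^sub>M n\<in>(UNIV::nat set). step_dist N r)"
    unfolding walk_space_def by (rule measurable_fst)
  have coord: "(\<lambda>\<omega>. fst \<omega> i) \<in> walk_space N r \<rightarrow>\<^sub>M ?C" for i
  proof -
    have "(\<lambda>\<omega>. fst \<omega> i) \<in> walk_space N r \<rightarrow>\<^sub>M step_dist N r"
      by (rule measurable_compose[OF fst_meas measurable_component_singleton]) simp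
    then show ?thesis
      by (simp only: measurable_cong_sets[OF refl sC])
  qed
  have coordC: "fst \<omega> i \<in> carrier ?G" if "\<omega> \<in> space (walk_space N r)" for \<omega> i
    using measurable_space[OF coord that] by simp
  have part: "(\<lambda>\<omega>. finprod ?G (fst \<omega>) {..<n}) \<in> walk_space N r \<rightarrow>\<^sub>M ?C" for n
  proof (induction n)
    case 0
    then show ?case by simp
  next
    case (Suc n)
    have "(\<lambda>\<omega>. fst \<omega> n \<otimes>\<^bsub>?G\<^esub> finprod ?G (fst \<omega>) {..<n}) \<in> walk_space N r \<rightarrow>\<^sub>M ?C"
      by (rule mult[OF coord Suc])
    moreover have "finprod ?G (fst \<omega>) {..<Suc n} = fst \<omega> n \<otimes>\<^bsub>?G\<^esub> finprod ?G (fst \<omega>) {..<n}"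
      if "\<omega> \<in> space (walk_space N r)" for \<omega>
      using coordC[OF that] by (simp add: lessThan_Suc)
    ultimately show ?case
      by (subst measurable_cong) auto
  qed
  have num: "(\<lambda>\<omega>. num_jumps (snd \<omega>) t) \<in> walk_space N r \<rightarrow>\<^sub>M count_space UNIV"
    unfolding walk_space_def
    by (rule measurable_compose[OF measurable_snd num_jumps_measurable])
  have "(\<lambda>\<omega>. finprod ?G (fst \<omega>) {..<num_jumps (snd \<omega>) t}) \<in> walk_space N r \<rightarrow>\<^sub>M ?C"
    by (rule measurable_compose_countable[OF part num])
  then have "(\<lambda>\<omega>. x \<otimes>\<^bsub>?G\<^esub> finprod ?G (fst \<omega>) {..<num_jumps (snd \<omega>) t}) \<in> walk_space N r \<rightarrow>\<^sub>M ?C"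
    using assms(2) by (intro mult) auto
  then show ?thesis
    by (simp add: walk_pos_def[abs_def])
qed

end

theory Submission
  imports Defs "HOL-Real_Asymp.Real_Asymp"
begin

text \<open>
  Let \<open>B\<^sub>k\<close> be the ball \<open>hball N k\<close>. The functions \<open>\<psi>\<^sub>k = 1\<^bsub>B\<^sub>k\<^esub> - 1\<^bsub>B\<^bsub>k+1\<^esub>\<^esub> / N\<close> are eigenfunctions of the
  step operator with eigenvalues \<open>1 - h\<^sub>k\<close>, where \<open>h\<^sub>k = (\<Sum>i>k. r i) + r (k + 1) / (N - 1)\<close>, and the
  indicator of the origin is the telescoping series \<open>\<Sum>k. \<psi>\<^sub>k / N ^ k\<close>. As the number of jumps up to
  time \<open>t\<close> is Poisson, \<open>p\<^sub>t(x, 0) = (\<Sum>k. exp (- t h\<^sub>k) \<psi>\<^sub>k(x) / N ^ k)\<close>. Integrating against \<open>t powr (\<zeta> - 1)\<close>,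
  the fractional potential of order \<open>\<zeta>\<close> is finite iff \<open>\<Sum>k. h\<^sub>k powr (- \<zeta>) / N ^ k\<close> converges.
  A bound \<open>a\<close> on the ratios \<open>c (j + 1) / c j\<close> compares \<open>h\<^sub>k\<close> with \<open>(a N powr (- 1 / \<mu>)) ^ k\<close>, so that the
  critical \<open>\<zeta>\<close> is compared with \<open>\<mu> / (1 - \<mu> ln a / ln N)\<close>; finally \<open>a\<close> tends to the limsup or liminf.
\<close>

section \<open>The number of jumps\<close>

abbreviation clock_space :: "(nat \<Rightarrow> real) measure" where
  "clock_space \<equiv> \<Pi>\<^sub>M n\<in>UNIV. density lborel (exponential_density 1)"

lemma prob_space_clock_space: "prob_space clock_space"
  by (intro prob_space_PiM prob_space_exponential_density) simp

lemma clock_component_measurable [measurable]: "(\<lambda>\<xi>. \<xi> i) \<in> borel_measurable clock_space"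
proof -
  have "(\<lambda>\<xi>. \<xi> i) \<in> clock_space \<rightarrow>\<^sub>M density lborel (exponential_density 1)"
    by (rule measurable_component_singleton) simp
  then show ?thesis by simp
qed

lemma distr_clock_component:
  "distr clock_space lborel (\<lambda>\<xi>. \<xi> i) = density lborel (exponential_density 1)"
proof -
  have "distr clock_space (density lborel (exponential_density 1)) (\<lambda>\<xi>. \<xi> i)
      = density lborel (exponential_density 1)"
    by (rule distr_PiM_component) (auto intro: prob_space_exponential_density)
  moreover have "distr clock_space (density lborel (exponential_density 1)) (\<lambda>\<xi>. \<xi> i)
      = distr clock_space lborel (\<lambda>\<xi>. \<xi> i)"
    by (rule distr_cong) auto
  ultimately show ?thesis by simp
qed

text \<open>The coordinates are independent because the identity map on \<open>clock_space\<close>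
  has the product of the coordinate laws as its law. The sum has \<open>n + 1\<close> exponential
  summands, which is shape \<open>n\<close> in \<open>erlang_density\<close>.\<close>

lemma clock_sum_erlang:
  "distributed clock_space lborel (\<lambda>\<xi>. \<Sum>i\<le>n. \<xi> i) (erlang_density n 1)"
proof -
  interpret prob_space clock_space by (rule prob_space_clock_space)
  let ?D = "density lborel (exponential_density 1)"
  have rv: "(\<lambda>\<xi>. \<xi> i) \<in> clock_space \<rightarrow>\<^sub>M ?D" for i
    by (rule measurable_component_singleton) simp
  have "indep_vars (\<lambda>_. ?D) (\<lambda>i \<xi>. \<xi> i) (UNIV :: nat set)"
  proof (subst indep_vars_iff_distr_eq_PiM')
    have "distr clock_space clock_space (\<lambda>x. \<lambda>i\<in>UNIV. x i) = clock_space"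
      using distr_id[of clock_space] by (simp add: id_def restrict_UNIV del: distr_id distr_id2)
    also have "\<dots> = (\<Pi>\<^sub>M i\<in>UNIV. distr clock_space ?D (\<lambda>\<xi>. \<xi> i))"
      by (intro PiM_cong refl distr_PiM_component[symmetric] prob_space_exponential_density) auto
    finally show "distr clock_space clock_space (\<lambda>x. \<lambda>i\<in>UNIV. x i)
      = (\<Pi>\<^sub>M i\<in>UNIV. distr clock_space ?D (\<lambda>\<xi>. \<xi> i))" .
  qed (use rv in auto)
  then have "indep_vars (\<lambda>_. borel) (\<lambda>i \<xi>. \<xi> i) (UNIV :: nat set)"
    by (rule indep_vars_compose2[where Y = "\<lambda>_ x. x", simplified]) auto
  then have ind: "indep_vars (\<lambda>_. borel) (\<lambda>i \<xi>. \<xi> i) {..n}"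
    by (rule indep_vars_subset) auto
  have "distributed clock_space lborel (\<lambda>\<xi>. \<xi> i) (exponential_density 1)" for i
    by (simp add: distributed_def distr_clock_component)
  from exponential_distributed_sum[OF _ _ _ this ind] show ?thesis by simp
qed

text \<open>Almost surely, at most \<open>n\<close> jumps by time \<open>t\<close> means that the
  partial sum up to index \<open>n\<close> exceeds \<open>t\<close>, and the Erlang tail is the
  Poisson distribution function. This reading of \<open>LEAST\<close> uses that almost surely no
  holding time is negative and some partial sum exceeds \<open>t\<close>.\<close>

lemma prob_num_jumps_le:
  assumes "t > 0"
  shows "measure clock_space {\<xi> \<in> space clock_space. num_jumps \<xi> t \<le> n}
    = (\<Sum>i\<le>n. pmf (poisson_pmf t) i)"
proof -
  interpret prob_space clock_space by (rule prob_space_clock_space)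
  have gt: "prob {\<xi> \<in> space clock_space. t < (\<Sum>i\<le>n. \<xi> i)} = (\<Sum>i\<le>n. pmf (poisson_pmf t) i)" for n
    using erlang_distributed_gt[OF clock_sum_erlang[of n], of t] assms
    by (simp add: erlang_CDF_def)
  have pos: "AE \<xi> in clock_space. \<forall>i. 0 \<le> \<xi> i"
  proof (subst AE_all_countable, intro allI)
    fix i
    have "AE x in density lborel (exponential_density 1). 0 \<le> x"
      by (subst AE_density) (auto simp: exponential_density_def)
    then show "AE \<xi> in clock_space. 0 \<le> \<xi> i"
      by (intro AE_PiM_component) (auto intro: prob_space_exponential_density)
  qed
  have ex: "AE \<xi> in clock_space. \<exists>n. t < (\<Sum>i\<le>n. \<xi> i)"
  proof -
    let ?E = "{\<xi> \<in> space clock_space. \<not> (\<exists>n. t < (\<Sum>i\<le>n. \<xi> i))}"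
    have m: "?E \<in> sets clock_space" by measurable
    \<comment> \<open>For every \<open>n\<close> the event lies in the complement of
      \<open>t < (\<Sum>i\<le>n. \<xi> i)\<close>, whose probability is a Poisson tail and tends to
      0.\<close>
    have le: "prob ?E \<le> 1 - (\<Sum>i\<le>n. pmf (poisson_pmf t) i)" for n
    proof -
      have "prob ?E \<le> prob (space clock_space - {\<xi> \<in> space clock_space. t < (\<Sum>i\<le>n. \<xi> i)})"
        by (rule finite_measure_mono) auto
      also have "\<dots> = 1 - (\<Sum>i\<le>n. pmf (poisson_pmf t) i)"
        by (subst prob_compl) (auto simp: gt)
      finally show ?thesis .
    qed
    have "(\<lambda>i. t ^ i / fact i) sums exp t"
      using exp_converges[of t] by (simp add: field_simps)
    from sums_mult2[OF this, of "exp (- t)"] have "pmf (poisson_pmf t) sums (exp t * exp (- t))"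
      using assms by (subst sums_cong[of _ "\<lambda>i. t ^ i / fact i * exp (- t)"]) auto
    then have "pmf (poisson_pmf t) sums 1"
      by (simp add: exp_minus)
    then have "(\<lambda>n. 1 - (\<Sum>i\<le>n. pmf (poisson_pmf t) i)) \<longlonglongrightarrow> 1 - 1"
      by (intro tendsto_intros) (simp add: sums_def_le)
    then have "prob ?E \<le> 1 - 1"
      by (rule LIMSEQ_le_const) (use le in auto)
    then have "prob ?E = 0"
      using measure_nonneg[of clock_space ?E] by linarith
    then show ?thesis
      using m by (subst (asm) prob_eq_0) (auto)
  qed
  have "AE \<xi> in clock_space. num_jumps \<xi> t \<le> n \<longleftrightarrow> t < (\<Sum>i\<le>n. \<xi> i)"
    using pos ex
  proof eventually_elim
    case (elim \<xi>)
    show ?case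
    proof
      assume le: "num_jumps \<xi> t \<le> n"
      have "t < (\<Sum>i\<le>num_jumps \<xi> t. \<xi> i)"
        unfolding num_jumps_def using elim(2) by (rule LeastI_ex)
      also have "\<dots> \<le> (\<Sum>i\<le>n. \<xi> i)"
        using le elim(1) by (intro sum_mono2) auto
      finally show "t < (\<Sum>i\<le>n. \<xi> i)" .
    qed (auto simp: num_jumps_def intro: Least_le)
  qed
  then have "prob {\<xi> \<in> space clock_space. num_jumps \<xi> t \<le> n}
      = prob {\<xi> \<in> space clock_space. t < (\<Sum>i\<le>n. \<xi> i)}"
  proof (rule finite_measure_eq_AE[OF AE_mp])
    note [measurable] = num_jumps_measurable
    show "{\<xi> \<in> space clock_space. num_jumps \<xi> t \<le> n} \<in> sets clock_space" by measurable
    show "{\<xi> \<in> space clock_space. t < (\<Sum>i\<le>n. \<xi> i)} \<in> sets clock_space" by measurable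
  qed auto
  then show ?thesis by (simp only: gt)
qed

lemma distr_num_jumps:
  assumes "t > 0"
  shows "distr clock_space (count_space UNIV) (\<lambda>\<xi>. num_jumps \<xi> t) = measure_pmf (poisson_pmf t)"
proof (rule measure_eqI_countable[where A = UNIV])
  interpret prob_space clock_space by (rule prob_space_clock_space)
  note [measurable] = num_jumps_measurable
  let ?P = "\<lambda>n. prob {\<xi> \<in> space clock_space. num_jumps \<xi> t \<le> n}"
  fix n
  have m: "{\<xi> \<in> space clock_space. num_jumps \<xi> t \<le> k} \<in> sets clock_space" for k
    by measurable
  have "prob {\<xi> \<in> space clock_space. num_jumps \<xi> t = n} = pmf (poisson_pmf t) n"
  proof (cases n)
    case 0
    with prob_num_jumps_le[OF assms, of 0] show ?thesis by simp
  next
    case (Suc k)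
    have "prob {\<xi> \<in> space clock_space. num_jumps \<xi> t = n}
        = prob ({\<xi> \<in> space clock_space. num_jumps \<xi> t \<le> Suc k}
            - {\<xi> \<in> space clock_space. num_jumps \<xi> t \<le> k})"
      unfolding Suc by (rule arg_cong[where f = prob]) auto
    also have "\<dots> = ?P (Suc k) - ?P k"
      by (rule finite_measure_Diff[OF m m]) auto
    also have "\<dots> = pmf (poisson_pmf t) n"
      unfolding prob_num_jumps_le[OF assms] using Suc by simp
    finally show ?thesis .
  qed
  moreover have "(\<lambda>\<xi>. num_jumps \<xi> t) -` {n} \<inter> space clock_space
      = {\<xi> \<in> space clock_space. num_jumps \<xi> t = n}" by auto
  ultimately show "emeasure (distr clock_space (count_space UNIV) (\<lambda>\<xi>. num_jumps \<xi> t)) {n}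
      = emeasure (measure_pmf (poisson_pmf t)) {n}"
    using num_jumps_measurable[of t]
    by (subst emeasure_distr) (simp_all only: emeasure_eq_measure emeasure_pmf_single, auto)
qed auto

lemma expectation_power_num_jumps:
  assumes "t > 0" "\<bar>a\<bar> \<le> 1"
  shows "(\<integral>\<xi>. a ^ num_jumps \<xi> t \<partial>clock_space) = exp (- t * (1 - a))"
proof -
  note [measurable] = num_jumps_measurable
  have "(\<integral>\<xi>. a ^ num_jumps \<xi> t \<partial>clock_space) = (\<integral>n. a ^ n \<partial>measure_pmf (poisson_pmf t))"
    by (subst distr_num_jumps[OF assms(1), symmetric], subst integral_distr) auto
  also have "\<dots> = (\<integral>n. pmf (poisson_pmf t) n * a ^ n \<partial>count_space UNIV)"
    unfolding measure_pmf_eq_density by (subst integral_density) auto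
  also have "\<dots> = exp (- t * (1 - a))"
  proof -
    \<comment> \<open>Proved for every base in [-1, 1], because absolute convergence is read off
      below from the base \<open>\<bar>a\<bar>\<close>.\<close>
    have s: "(\<lambda>n. pmf (poisson_pmf t) n * a ^ n) sums exp (- t * (1 - a))" if "\<bar>a\<bar> \<le> 1" for a
    proof -
      have "(\<lambda>n. (t * a) ^ n / fact n) sums exp (t * a)"
        using exp_converges[of "t * a"] by (simp add: field_simps)
      from sums_mult[OF this, of "exp (- t)"] show ?thesis
        using assms(1) by (simp add: power_mult_distrib exp_add[symmetric] algebra_simps)
    qed
    have "summable (\<lambda>n. norm (pmf (poisson_pmf t) n * a ^ n))"
      using sums_summable[OF s[of "\<bar>a\<bar>"]] assms by (simp add: norm_mult norm_power abs_mult power_abs)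
    then have "integrable (count_space UNIV) (\<lambda>n. pmf (poisson_pmf t) n * a ^ n)"
      by (subst integrable_count_space_nat_iff)
    from integral_count_space_nat[OF this] sums_unique[OF s[OF assms(2)]] show ?thesis by simp
  qed
  finally show ?thesis .
qed

section \<open>Spectral analysis of the walk\<close>

lemma hball_mono: "j \<le> k \<Longrightarrow> hball N j \<subseteq> hball N k"
  by (auto simp: hball_def)

lemma hball_0:
  assumes "N > 0"
  shows "hball N 0 = {\<one>\<^bsub>hgroup N\<^esub>}"
proof -
  interpret G: comm_group "hgroup N" by (rule comm_group_hgroup)
  show ?thesis
    using hnorm_eq_0_iff[OF assms] by (auto simp: hball_def)
qed

lemma subgroup_hball:
  assumes "N > 0"
  shows "subgroup (hball N k) (hgroup N)"
proof -
  interpret G: comm_group "hgroup N" by (rule comm_group_hgroup)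
  show ?thesis
  proof (rule G.subgroupI)
    show "hball N k \<noteq> {}"
      using hball_mono[of 0 k N] hball_0[OF assms] by auto
  next
    fix a b assume "a \<in> hball N k" "b \<in> hball N k"
    then show "a \<otimes>\<^bsub>hgroup N\<^esub> b \<in> hball N k"
      using assms G.m_closed by (simp add: hball_alt) (simp add: mult_hgroup)
  next
    fix a assume "a \<in> hball N k"
    then have a: "a \<in> carrier (hgroup N)" and z: "\<And>i. i > k \<Longrightarrow> a i = 0"
      using assms by (auto simp: hball_alt)
    let ?b = "inv\<^bsub>hgroup N\<^esub> a"
    have b: "?b \<in> carrier (hgroup N)" using a by simp
    \<comment> \<open>The product of \<open>a\<close> and its inverse has coordinate 0 here, so the
      coordinate of the inverse is 0 mod \<open>N\<close>, and hence 0 as a representative in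
      \<open>{0..<int N}\<close>. The index is a relevant one, as \<open>i > k\<close> forces
      \<open>i \<ge> 1\<close>.\<close>
    have "?b i = 0" if i: "i > k" for i
    proof -
      have "(a \<otimes>\<^bsub>hgroup N\<^esub> ?b) i = \<one>\<^bsub>hgroup N\<^esub> i" using a by simp
      with i z have "?b i mod int N = 0" by (simp add: mult_hgroup one_hgroup)
      moreover have "?b i \<in> {0..<int N}"
        using b i assms by (auto simp: carrier_hgroup PiE_iff)
      ultimately show ?thesis by simp
    qed
    with b show "?b \<in> hball N k" using assms by (simp add: hball_alt)
  qed (auto simp: hball_def)
qed

locale hierarchical_walk =
  fixes N :: nat and r :: "nat \<Rightarrow> real"
  assumes N: "N \<ge> 2" and r_pos: "\<And>j. r (Suc j) > 0" and r_sums: "(\<lambda>j. r (Suc j)) sums 1"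
begin

abbreviation "G \<equiv> hgroup N"

sublocale G: comm_group "hgroup N" by (rule comm_group_hgroup)

sublocale step: prob_space "step_dist N r"
  using N r_pos r_sums by (intro prob_space_step_dist) (auto intro: less_imp_le)

sublocale steps: sequence_space "step_dist N r"
  by unfold_locales

sublocale clock: prob_space clock_space by (rule prob_space_clock_space)

sublocale walk: pair_prob_space steps.S clock_space
  by unfold_locales

lemma walk_space_eq: "walk_space N r = steps.S \<Otimes>\<^sub>M clock_space"
  by (simp add: walk_space_def)

lemma N_pos: "N > 0" using N by simp

lemma space_step: "space (step_dist N r) = carrier G"
  by (simp add: step_dist_def space_point_measure)

lemma sets_step: "sets (step_dist N r) = Pow (carrier G)"
  by (simp add: step_dist_def sets_point_measure)

section \<open>Step probabilities of balls and of their translates\<close>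

lemma mult_hball_iff:
  assumes "x \<in> hball N k" "s \<in> carrier G"
  shows "x \<otimes>\<^bsub>G\<^esub> s \<in> hball N k \<longleftrightarrow> s \<in> hball N k"
proof
  interpret H: subgroup "hball N k" G by (rule subgroup_hball[OF N_pos])
  have x: "x \<in> carrier G" using assms(1) by (rule H.mem_carrier)
  assume "x \<otimes>\<^bsub>G\<^esub> s \<in> hball N k"
  then have "inv\<^bsub>G\<^esub> x \<otimes>\<^bsub>G\<^esub> (x \<otimes>\<^bsub>G\<^esub> s) \<in> hball N k"
    by (rule H.m_closed[OF H.m_inv_closed[OF assms(1)]])
  then show "s \<in> hball N k"
    using x assms(2) by (metis G.inv_closed G.l_inv G.l_one G.m_assoc)
next
  interpret H: subgroup "hball N k" G by (rule subgroup_hball[OF N_pos])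
  show "s \<in> hball N k \<Longrightarrow> x \<otimes>\<^bsub>G\<^esub> s \<in> hball N k"
    using assms(1) by (rule H.m_closed)
qed

text \<open>The ball grows sphere by sphere, and the sphere of radius \<open>Suc k\<close> has mass
  \<open>r (Suc k)\<close>. The ball of radius 0 is null because a step is never the
  identity.\<close>

lemma prob_hball: "step.prob (hball N k) = (\<Sum>i<k. r (Suc i))"
proof (induction k)
  case 0
  have "step.prob (hball N 0) = step.prob {}"
  proof (rule step.finite_measure_eq_AE)
    show "AE x in step_dist N r. x \<in> hball N 0 \<longleftrightarrow> x \<in> {}"
      unfolding step_dist_def
      by (subst AE_point_measure) (auto simp: hball_0[OF N_pos] step_prob_def)
  qed (auto simp: sets_step hball_def)
  then show ?case by simp
next
  case (Suc k)
  let ?S = "{x \<in> carrier G. hnorm N x = Suc k}"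
  have "hball N (Suc k) = hball N k \<union> ?S" by (auto simp: hball_def)
  moreover have "step.prob (hball N k \<union> ?S) = step.prob (hball N k) + step.prob ?S"
    by (rule step.finite_measure_Union) (auto simp: sets_step hball_def)
  moreover have "step.prob ?S = r (Suc k)"
    using emeasure_step_dist_sphere[OF N, of r k] r_pos[of k]
    by (simp add: step.emeasure_eq_measure)
  ultimately show ?case using Suc by simp
qed

text \<open>Ultrametric argument: the ball of radius \<open>hnorm N x\<close> contains
  \<open>x\<close> and the product, hence \<open>s\<close>. If \<open>s\<close> had smaller norm,
  the ball one size down would contain \<open>s\<close> and the product, hence
  \<open>x\<close>.\<close>

lemma hnorm_of_mult_hball:
  assumes "x \<in> carrier G" "s \<in> carrier G" "x \<otimes>\<^bsub>G\<^esub> s \<in> hball N k" "hnorm N x > k"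
  shows "hnorm N s = hnorm N x"
proof -
  have le: "hnorm N s \<le> hnorm N x"
  proof -
    have "x \<in> hball N (hnorm N x)" using assms(1) by (simp add: hball_def)
    moreover have "x \<otimes>\<^bsub>G\<^esub> s \<in> hball N (hnorm N x)"
      using assms(3,4) hball_mono[of k "hnorm N x" N] by auto
    ultimately have "s \<in> hball N (hnorm N x)"
      using assms(2) by (simp add: mult_hball_iff)
    then show ?thesis by (simp add: hball_def)
  qed
  have "\<not> hnorm N s < hnorm N x"
  proof
    assume lt: "hnorm N s < hnorm N x"
    let ?m = "hnorm N x - 1"
    have "s \<in> hball N ?m" using assms(2) lt by (simp add: hball_def)
    moreover have "hball N k \<subseteq> hball N ?m"
      using assms(4) by (intro hball_mono) simp
    with assms have "s \<otimes>\<^bsub>G\<^esub> x \<in> hball N ?m"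
      by (auto simp: G.m_comm)
    ultimately have "x \<in> hball N ?m"
      using assms(1) by (simp add: mult_hball_iff)
    then have "hnorm N x \<le> ?m" by (simp add: hball_def)
    with lt show False by linarith
  qed
  with le show ?thesis by simp
qed

text \<open>The steps in question form a coset of the ball, with \<open>N ^ k\<close> elements, and
  \<open>hnorm_of_mult_hball\<close> makes \<open>step_prob\<close> constant on it.\<close>

lemma prob_mult_hball:
  assumes "x \<in> carrier G" "hnorm N x > k"
  shows "step.prob {s \<in> carrier G. x \<otimes>\<^bsub>G\<^esub> s \<in> hball N k}
    = real N ^ k * r (hnorm N x) / (real N ^ (hnorm N x - 1) * (real N - 1))"
proof -
  let ?A = "{s \<in> carrier G. x \<otimes>\<^bsub>G\<^esub> s \<in> hball N k}"
  let ?q = "r (hnorm N x) / (real N ^ (hnorm N x - 1) * (real N - 1))"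
  have hb: "hball N k \<subseteq> carrier G" by (auto simp: hball_def)
  have eq: "?A = (\<lambda>b. inv\<^bsub>G\<^esub> x \<otimes>\<^bsub>G\<^esub> b) ` hball N k"
  proof (intro Set.set_eqI iffI)
    fix s assume "s \<in> ?A"
    then show "s \<in> (\<lambda>b. inv\<^bsub>G\<^esub> x \<otimes>\<^bsub>G\<^esub> b) ` hball N k"
      using assms(1) by (intro image_eqI[where x = "x \<otimes>\<^bsub>G\<^esub> s"]) (auto simp: G.m_assoc[symmetric])
  next
    fix s assume "s \<in> (\<lambda>b. inv\<^bsub>G\<^esub> x \<otimes>\<^bsub>G\<^esub> b) ` hball N k"
    then show "s \<in> ?A"
      using assms(1) hb by (auto simp: G.m_assoc[symmetric])
  qed
  have inj: "inj_on (\<lambda>b. inv\<^bsub>G\<^esub> x \<otimes>\<^bsub>G\<^esub> b) (hball N k)"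
    using assms(1) hb by (intro inj_onI) (auto simp: subset_iff)
  have fin: "finite ?A" and card: "card ?A = N ^ k"
    unfolding eq using finite_card_hball[OF N_pos, of k] by (auto simp: card_image[OF inj])
  have "step_prob N r s = ?q" if "s \<in> ?A" for s
  proof -
    have n: "hnorm N s = hnorm N x" using that assms by (intro hnorm_of_mult_hball) auto
    moreover have "s \<noteq> \<one>\<^bsub>G\<^esub>" using n assms(2) by (auto simp: hnorm_def)
    ultimately show ?thesis by (simp add: step_prob_def)
  qed
  moreover have "?q \<ge> 0"
    using r_pos[of "hnorm N x - 1"] assms(2) N by (auto intro!: divide_nonneg_nonneg)
  ultimately have "emeasure (step_dist N r) ?A = of_nat (card ?A) * ennreal ?q"
    unfolding step_dist_def using fin
    by (subst emeasure_point_measure_finite2) auto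
  also have "\<dots> = ennreal (real (card ?A) * ?q)"
    using \<open>?q \<ge> 0\<close> by (subst ennreal_mult) (auto simp: ennreal_of_nat_eq_real_of_nat)
  finally have "step.prob ?A = real (card ?A) * ?q"
    using mult_nonneg_nonneg[OF of_nat_0_le_iff \<open>?q \<ge> 0\<close>]
    unfolding step.emeasure_eq_measure by (subst (asm) ennreal_inj) auto
  then show ?thesis by (simp add: card)
qed

text \<open>Averaging over \<open>x \<otimes> B\<^sub>i\<close> fixes this function if \<open>i \<le> k\<close> and annihilates it if \<open>i > k\<close>, and the
  step law is a signed mixture of the uniform laws on balls. Hence it is a common eigenfunction,
  and characters of the group can be avoided.\<close>

definition eigfun :: "nat \<Rightarrow> (nat \<Rightarrow> int) \<Rightarrow> real" where
  "eigfun k x = indicator (hball N k) x - indicator (hball N (Suc k)) x / real N"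

text \<open>Averaging over a sphere of radius at most \<open>k\<close> fixes
  \<open>eigfun k\<close>, over a sphere of radius beyond \<open>k + 1\<close> it gives 0. The
  sphere of radius \<open>k + 1\<close> is a ball minus a subball of one \<open>N\<close>-th its
  size, and contributes the factor -1 / (N - 1).\<close>

definition eigval :: "nat \<Rightarrow> real" where
  "eigval k = (\<Sum>i<k. r (Suc i)) - r (Suc k) / (real N - 1)"

lemma abs_eigfun_le_1: "\<bar>eigfun k x\<bar> \<le> 1"
  using N by (auto simp: eigfun_def field_simps split: split_indicator)

lemma eigfun_one: "eigfun k \<one>\<^bsub>G\<^esub> = 1 - 1 / real N"
  by (simp add: eigfun_def hball_def hnorm_def)

lemma integral_eigfun_step:
  assumes x: "x \<in> carrier G"
  shows "(\<integral>s. eigfun k (x \<otimes>\<^bsub>G\<^esub> s) \<partial>step_dist N r) = eigval k * eigfun k x"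
proof -
  let ?A = "\<lambda>k. {s \<in> carrier G. x \<otimes>\<^bsub>G\<^esub> s \<in> hball N k}"
  have A: "?A k \<in> sets (step_dist N r)" for k by (auto simp: sets_step)
  have "(\<integral>s. eigfun k (x \<otimes>\<^bsub>G\<^esub> s) \<partial>step_dist N r)
      = (\<integral>s. indicator (?A k) s - indicator (?A (Suc k)) s / real N \<partial>step_dist N r)"
    by (intro Bochner_Integration.integral_cong refl)
      (auto simp: eigfun_def space_step split: split_indicator)
  also have "\<dots> = step.prob (?A k) - step.prob (?A (Suc k)) / real N"
    using A by (subst Bochner_Integration.integral_diff)
      (auto simp: step.emeasure_eq_measure)
  also have "\<dots> = eigval k * eigfun k x"
  proof -
    have small: "step.prob (?A j) = (\<Sum>i<j. r (Suc i))" if "hnorm N x \<le> j" for j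
    proof -
      have "?A j = hball N j"
        using that x mult_hball_iff[of x j] by (auto simp: hball_def)
      then show ?thesis by (simp add: prob_hball)
    qed
    have mem: "x \<in> hball N j \<longleftrightarrow> hnorm N x \<le> j" for j
      using x by (simp add: hball_def)
    \<comment> \<open>On these ranges \<open>eigfun k x\<close> is 1 - 1/N, -1/N and 0. In the last
      one the probability of \<open>?A (Suc k)\<close> is exactly \<open>N\<close> times that of
      \<open>?A k\<close>, so the difference vanishes.\<close>
    consider "hnorm N x \<le> k" | "hnorm N x = Suc k" | "hnorm N x > Suc k" by linarith
    then show ?thesis
    proof cases
      case 1
      then show ?thesis
        using x N by (simp add: small eigval_def eigfun_def mem field_simps)
    next
      case 2
      then show ?thesis
        using x N by (simp add: small prob_mult_hball eigval_def eigfun_def mem field_simps)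
    next
      case 3
      then show ?thesis
        using x N by (simp add: prob_mult_hball eigval_def eigfun_def mem field_simps)
    qed
  qed
  finally show ?thesis .
qed

text \<open>The strict upper bound comes from the positive tail of the weights and makes all decay
  rates positive; the lower one uses \<open>N - 1 \<ge> 1\<close>. Together they meet the hypothesis
  of \<open>expectation_power_num_jumps\<close>.\<close>

lemma eigval_bounds: "-1 \<le> eigval k" "eigval k < 1"
proof -
  have s: "summable (\<lambda>j. r (Suc j))" using r_sums by (rule sums_summable)
  have le: "(\<Sum>i<n. r (Suc i)) < 1" for n
    using sum_less_suminf[OF s, of n] r_pos sums_unique[OF r_sums] by auto
  have nn: "0 \<le> (\<Sum>i<n. r (Suc i))" for n
    by (intro sum_nonneg less_imp_le r_pos)
  have r1: "r (Suc k) \<le> 1" using le[of "Suc k"] nn[of k] by simp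
  have "r (Suc k) / (real N - 1) \<le> r (Suc k) / 1"
    using N r_pos[of k] by (intro divide_left_mono) auto
  with r1 have "r (Suc k) / (real N - 1) \<le> 1" by simp
  with nn[of k] show "-1 \<le> eigval k" by (simp add: eigval_def)
  have "r (Suc k) / (real N - 1) \<ge> 0"
    using N r_pos[of k] by simp
  with le[of k] show "eigval k < 1" by (simp add: eigval_def)
qed

section \<open>From one step to the continuous-time walk and its transition probabilities\<close>

lemma steps_in_carrier: "\<omega> \<in> space steps.S \<Longrightarrow> \<omega> i \<in> carrier G"
  by (auto simp: space_PiM space_step PiE_iff)

lemma measurable_mult:
  assumes f: "f \<in> L \<rightarrow>\<^sub>M count_space (carrier G)" and g: "g \<in> L \<rightarrow>\<^sub>M count_space (carrier G)"
  shows "(\<lambda>\<omega>. f \<omega> \<otimes>\<^bsub>G\<^esub> g \<omega>) \<in> L \<rightarrow>\<^sub>M count_space (carrier G)"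
proof -
  have "(\<lambda>\<omega>. (\<lambda>a \<omega>. a \<otimes>\<^bsub>G\<^esub> g \<omega>) (f \<omega>) \<omega>) \<in> L \<rightarrow>\<^sub>M count_space (carrier G)"
  proof (rule measurable_compose_countable'[OF _ f countable_carrier_hgroup[OF N_pos]])
    fix a assume "a \<in> carrier G"
    then have "(\<lambda>b. a \<otimes>\<^bsub>G\<^esub> b) \<in> count_space (carrier G) \<rightarrow>\<^sub>M count_space (carrier G)"
      by simp
    then show "(\<lambda>\<omega>. a \<otimes>\<^bsub>G\<^esub> g \<omega>) \<in> L \<rightarrow>\<^sub>M count_space (carrier G)"
      by (rule measurable_compose[OF g])
  qed
  then show ?thesis by simp
qed

lemma measurable_step_component: "(\<lambda>\<omega>. \<omega> i) \<in> steps.S \<rightarrow>\<^sub>M count_space (carrier G)"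
proof -
  have "(\<lambda>\<omega>. \<omega> i) \<in> steps.S \<rightarrow>\<^sub>M step_dist N r"
    by (rule measurable_component_singleton) simp
  then show ?thesis
    by (simp add: measurable_cong_sets[OF refl, of "step_dist N r" "count_space (carrier G)"] sets_step)
qed

lemma measurable_partial_prod:
  assumes "x \<in> carrier G"
  shows "(\<lambda>\<omega>. x \<otimes>\<^bsub>G\<^esub> finprod G \<omega> {..<n}) \<in> steps.S \<rightarrow>\<^sub>M count_space (carrier G)"
proof -
  have "(\<lambda>\<omega>. finprod G \<omega> {..<n}) \<in> steps.S \<rightarrow>\<^sub>M count_space (carrier G)"
  proof (induction n)
    case (Suc n)
    have "(\<lambda>\<omega>. \<omega> n \<otimes>\<^bsub>G\<^esub> finprod G \<omega> {..<n}) \<in> steps.S \<rightarrow>\<^sub>M count_space (carrier G)"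
      by (rule measurable_mult[OF measurable_step_component Suc])
    moreover have "finprod G \<omega> {..<Suc n} = \<omega> n \<otimes>\<^bsub>G\<^esub> finprod G \<omega> {..<n}"
      if "\<omega> \<in> space steps.S" for \<omega>
      using steps_in_carrier[OF that] by (simp add: lessThan_Suc)
    ultimately show ?case by (subst measurable_cong) auto
  qed simp
  then show ?thesis using assms by (intro measurable_mult) auto
qed

text \<open>Separates the first step instead of the last one, because \<open>steps.PiM_iter\<close>
  extends a sequence at its front.\<close>

lemma finprod_case_nat:
  assumes s: "s \<in> carrier G" and \<omega>: "\<And>i. \<omega> i \<in> carrier G"
  shows "finprod G (case_nat s \<omega>) {..<Suc n} = s \<otimes>\<^bsub>G\<^esub> finprod G \<omega> {..<n}"
proof -
  have "finprod G (case_nat s \<omega>) {..<Suc n}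
      = finprod G (case_nat s \<omega>) (insert 0 (Suc ` {..<n}))"
    by (simp only: lessThan_Suc_eq_insert_0)
  also have "\<dots> = s \<otimes>\<^bsub>G\<^esub> finprod G (case_nat s \<omega>) (Suc ` {..<n})"
    using s \<omega> by (subst G.finprod_insert) auto
  also have "finprod G (case_nat s \<omega>) (Suc ` {..<n}) = finprod G (\<lambda>i. case_nat s \<omega> (Suc i)) {..<n}"
    using \<omega> by (intro G.finprod_reindex) auto
  finally show ?thesis by simp
qed

text \<open>First-step analysis: the induction hypothesis is applied from the position after the
  first step, hence the arbitrary \<open>x\<close>, and \<open>integral_eigfun_step\<close> then
  supplies one more factor.\<close>

lemma integral_eigfun_steps:
  assumes "x \<in> carrier G"
  shows "(\<integral>\<omega>. eigfun k (x \<otimes>\<^bsub>G\<^esub> finprod G \<omega> {..<n}) \<partial>steps.S) = eigval k ^ n * eigfun k x"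
  using assms
proof (induction n arbitrary: x)
  case 0
  then show ?case by (simp add: steps.P.prob_space)
next
  case (Suc n x)
  interpret P: pair_prob_space "step_dist N r" steps.S by unfold_locales
  let ?f = "\<lambda>\<omega>. eigfun k (x \<otimes>\<^bsub>G\<^esub> finprod G \<omega> {..<Suc n})"
  have mf: "?f \<in> borel_measurable steps.S"
    by (rule measurable_compose[OF measurable_partial_prod[OF Suc.prems]]) simp
  have mc: "(\<lambda>(s, \<omega>). case_nat s \<omega>) \<in> step_dist N r \<Otimes>\<^sub>M steps.S \<rightarrow>\<^sub>M steps.S"
    by measurable
  \<comment> \<open>Prepending an independent step to an i.i.d. sequence does not change its
    law.\<close>
  have "(\<integral>\<omega>. ?f \<omega> \<partial>steps.S)
      = (\<integral>\<omega>. ?f \<omega> \<partial>distr (step_dist N r \<Otimes>\<^sub>M steps.S) steps.S (\<lambda>(s, \<omega>). case_nat s \<omega>))"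
    by (simp only: steps.PiM_iter)
  also have "\<dots> = (\<integral>p. ?f (case p of (s, \<omega>) \<Rightarrow> case_nat s \<omega>) \<partial>(step_dist N r \<Otimes>\<^sub>M steps.S))"
    by (rule integral_distr[OF mc mf])
  also have "\<dots> = (\<integral>s. \<integral>\<omega>. ?f (case_nat s \<omega>) \<partial>steps.S \<partial>step_dist N r)"
  proof (subst P.integral_fst'[symmetric])
    show "integrable (step_dist N r \<Otimes>\<^sub>M steps.S) (\<lambda>p. ?f (case p of (s, \<omega>) \<Rightarrow> case_nat s \<omega>))"
      using measurable_compose[OF mc mf] abs_eigfun_le_1
      by (intro P.integrable_const_bound[where B = 1]) auto
  qed simp
  also have "\<dots> = (\<integral>s. eigval k ^ n * eigfun k (x \<otimes>\<^bsub>G\<^esub> s) \<partial>step_dist N r)"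
  proof (rule Bochner_Integration.integral_cong[OF refl])
    fix s assume "s \<in> space (step_dist N r)"
    then have s: "s \<in> carrier G" by (simp add: space_step)
    have "(\<integral>\<omega>. ?f (case_nat s \<omega>) \<partial>steps.S)
        = (\<integral>\<omega>. eigfun k ((x \<otimes>\<^bsub>G\<^esub> s) \<otimes>\<^bsub>G\<^esub> finprod G \<omega> {..<n}) \<partial>steps.S)"
    proof (rule Bochner_Integration.integral_cong[OF refl])
      fix \<omega> assume "\<omega> \<in> space steps.S"
      then have \<omega>: "\<omega> i \<in> carrier G" for i by (rule steps_in_carrier)
      then have "finprod G \<omega> {..<n} \<in> carrier G" by (intro G.finprod_closed) auto
      then show "?f (case_nat s \<omega>) = eigfun k ((x \<otimes>\<^bsub>G\<^esub> s) \<otimes>\<^bsub>G\<^esub> finprod G \<omega> {..<n})"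
        using s Suc.prems by (simp only: finprod_case_nat[OF s \<omega>] G.m_assoc)
    qed
    also have "\<dots> = eigval k ^ n * eigfun k (x \<otimes>\<^bsub>G\<^esub> s)"
      using s Suc.prems by (intro Suc.IH) auto
    finally show "(\<integral>\<omega>. ?f (case_nat s \<omega>) \<partial>steps.S) = eigval k ^ n * eigfun k (x \<otimes>\<^bsub>G\<^esub> s)" .
  qed
  also have "\<dots> = eigval k ^ Suc n * eigfun k x"
    using Suc.prems by (simp add: integral_eigfun_step)
  finally show ?case .
qed

definition rate :: "nat \<Rightarrow> real" where
  "rate k = 1 - eigval k"

lemma rate_pos: "rate k > 0"
  using eigval_bounds(2)[of k] by (simp add: rate_def)

lemma walk_pos_in_carrier:
  "x \<in> carrier G \<Longrightarrow> \<omega> \<in> space (walk_space N r) \<Longrightarrow> walk_pos N x t \<omega> \<in> carrier G"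
  using measurable_space[OF walk_pos_measurable[OF N_pos]] by simp

text \<open>With the clock frozen, the steps contribute \<open>eigval k ^ num_jumps \<xi> t\<close>;
  what remains is the Poisson generating function.\<close>

lemma integral_eigfun_walk:
  assumes x: "x \<in> carrier G" and t: "t > 0"
  shows "(\<integral>\<omega>. eigfun k (walk_pos N x t \<omega>) \<partial>walk_space N r) = exp (- t * rate k) * eigfun k x"
proof -
  have m: "(\<lambda>\<omega>. eigfun k (walk_pos N x t \<omega>)) \<in> borel_measurable (walk_space N r)"
    by (rule measurable_compose[OF walk_pos_measurable[OF N_pos x]]) simp
  have "(\<integral>\<omega>. eigfun k (walk_pos N x t \<omega>) \<partial>walk_space N r)
      = (\<integral>\<xi>. \<integral>\<omega>. eigfun k (walk_pos N x t (\<omega>, \<xi>)) \<partial>steps.S \<partial>clock_space)"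
  proof -
    have "integrable (steps.S \<Otimes>\<^sub>M clock_space) (\<lambda>(\<omega>, \<xi>). eigfun k (walk_pos N x t (\<omega>, \<xi>)))"
      using m abs_eigfun_le_1 unfolding walk_space_eq
      by (intro walk.integrable_const_bound[where B = 1]) auto
    from walk.integral_snd[OF this] show ?thesis
      by (simp add: walk_space_eq case_prod_unfold)
  qed
  also have "\<dots> = (\<integral>\<xi>. eigval k ^ num_jumps \<xi> t * eigfun k x \<partial>clock_space)"
    by (simp add: walk_pos_def integral_eigfun_steps[OF x])
  also have "\<dots> = exp (- t * rate k) * eigfun k x"
    using expectation_power_num_jumps[OF t, of "eigval k"] eigval_bounds[of k]
    by (simp add: rate_def abs_le_iff)
  finally show ?thesis .
qed

lemma sum_eigfun:
  "(\<Sum>k<K. eigfun k x / real N ^ k) = indicator (hball N 0) x - indicator (hball N K) x / real N ^ K"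
proof (induction K)
  case (Suc K)
  have "eigfun K x / real N ^ K
      = indicator (hball N K) x / real N ^ K - indicator (hball N (Suc K)) x / real N ^ Suc K"
    by (simp add: eigfun_def diff_divide_distrib)
  with Suc show ?case by simp
qed simp

text \<open>Taking expectations in the telescoping identity \<open>sum_eigfun\<close> leaves as
  remainder the probability of being in \<open>hball N K\<close>, divided by \<open>N ^ K\<close>,
  which tends to 0.\<close>

lemma trans_prob_one_sums:
  assumes x: "x \<in> carrier G" and t: "t > 0"
  shows "(\<lambda>k. exp (- t * rate k) * eigfun k x / real N ^ k) sums trans_prob N r t x \<one>\<^bsub>G\<^esub>"
proof -
  interpret W: prob_space "walk_space N r"
    using N r_pos r_sums by (intro prob_space_walk_space) (auto intro: less_imp_le)
  let ?w = "walk_pos N x t"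
  note mw = walk_pos_measurable[OF N_pos x]
  have int: "integrable (walk_space N r) (\<lambda>\<omega>. f (?w \<omega>))" if "\<And>y. \<bar>f y\<bar> \<le> (1::real)" for f
    using that measurable_compose[OF mw, of f borel]
    by (intro W.integrable_const_bound[where B = 1]) auto
  have int_ind: "integrable (walk_space N r) (\<lambda>\<omega>. indicator (hball N K) (?w \<omega>) :: real)" for K
    by (rule int) (auto split: split_indicator)
  have p: "trans_prob N r t x \<one>\<^bsub>G\<^esub> = (\<integral>\<omega>. indicator (hball N 0) (?w \<omega>) \<partial>walk_space N r)"
  proof -
    have "{\<omega> \<in> space (walk_space N r). ?w \<omega> = \<one>\<^bsub>G\<^esub>} = ?w -` {\<one>\<^bsub>G\<^esub>} \<inter> space (walk_space N r)"
      by auto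
    moreover have "\<dots> \<in> sets (walk_space N r)"
      by (rule measurable_sets[OF mw]) simp
    ultimately have "trans_prob N r t x \<one>\<^bsub>G\<^esub>
        = (\<integral>\<omega>. indicator (?w -` {\<one>\<^bsub>G\<^esub>} \<inter> space (walk_space N r)) \<omega> \<partial>walk_space N r)"
      by (simp add: trans_prob_def)
    also have "\<dots> = (\<integral>\<omega>. indicator (hball N 0) (?w \<omega>) \<partial>walk_space N r)"
      by (rule Bochner_Integration.integral_cong[OF refl])
        (auto simp: hball_0[OF N_pos] split: split_indicator)
    finally show ?thesis .
  qed
  have eq: "(\<Sum>k<K. exp (- t * rate k) * eigfun k x / real N ^ k)
      = trans_prob N r t x \<one>\<^bsub>G\<^esub> - (\<integral>\<omega>. indicator (hball N K) (?w \<omega>) \<partial>walk_space N r) / real N ^ K" for K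
  proof -
    have "(\<Sum>k<K. exp (- t * rate k) * eigfun k x / real N ^ k)
        = (\<Sum>k<K. \<integral>\<omega>. eigfun k (?w \<omega>) / real N ^ k \<partial>walk_space N r)"
      by (simp add: integral_eigfun_walk[OF x t])
    also have "\<dots> = (\<integral>\<omega>. (\<Sum>k<K. eigfun k (?w \<omega>) / real N ^ k) \<partial>walk_space N r)"
      by (rule Bochner_Integration.integral_sum[symmetric]) (intro Bochner_Integration.integrable_divide int abs_eigfun_le_1)
    also have "\<dots> = (\<integral>\<omega>. indicator (hball N 0) (?w \<omega>) - indicator (hball N K) (?w \<omega>) / real N ^ K
        \<partial>walk_space N r)"
      by (simp only: sum_eigfun)
    also have "\<dots> = trans_prob N r t x \<one>\<^bsub>G\<^esub>
        - (\<integral>\<omega>. indicator (hball N K) (?w \<omega>) \<partial>walk_space N r) / real N ^ K"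
      unfolding p using int_ind by (subst Bochner_Integration.integral_diff) auto
    finally show ?thesis .
  qed
  have "(\<lambda>K. (\<integral>\<omega>. indicator (hball N K) (?w \<omega>) \<partial>walk_space N r) / real N ^ K) \<longlonglongrightarrow> 0"
  proof (rule tendsto_sandwich)
    have b: "0 \<le> (\<integral>\<omega>. indicator (hball N K) (?w \<omega>) \<partial>walk_space N r :: real)"
      "(\<integral>\<omega>. indicator (hball N K) (?w \<omega>) \<partial>walk_space N r) \<le> (1::real)" for K
    proof -
      show "0 \<le> (\<integral>\<omega>. indicator (hball N K) (?w \<omega>) \<partial>walk_space N r :: real)"
        by (rule Bochner_Integration.integral_nonneg) simp
      have "(\<integral>\<omega>. indicator (hball N K) (?w \<omega>) \<partial>walk_space N r :: real) \<le> (\<integral>\<omega>. 1 \<partial>walk_space N r)"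
        using int_ind by (intro integral_mono) (auto split: split_indicator)
      then show "(\<integral>\<omega>. indicator (hball N K) (?w \<omega>) \<partial>walk_space N r) \<le> (1::real)"
        by (simp add: W.prob_space)
    qed
    show "\<forall>\<^sub>F K in sequentially. 0 \<le> (\<integral>\<omega>. indicator (hball N K) (?w \<omega>) \<partial>walk_space N r) / real N ^ K"
      using b by (intro always_eventually allI divide_nonneg_nonneg) auto
    show "\<forall>\<^sub>F K in sequentially.
        (\<integral>\<omega>. indicator (hball N K) (?w \<omega>) \<partial>walk_space N r) / real N ^ K \<le> 1 / real N ^ K"
      using b by (intro always_eventually allI divide_right_mono) auto
    show "(\<lambda>K. 1 / real N ^ K) \<longlonglongrightarrow> 0"
      using N LIMSEQ_power_zero[of "1 / real N"] by (simp add: power_one_over)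
  qed simp
  from tendsto_diff[OF tendsto_const this, of "trans_prob N r t x \<one>\<^bsub>G\<^esub>"]
  show ?thesis
    unfolding sums_def eq by simp
qed

text \<open>Left translation by the inverse of \<open>y\<close> commutes with the walk path by path,
  so every target can be moved to the identity.\<close>

lemma trans_prob_translate:
  assumes x: "x \<in> carrier G" and y: "y \<in> carrier G"
  shows "trans_prob N r t x y = trans_prob N r t (inv\<^bsub>G\<^esub> y \<otimes>\<^bsub>G\<^esub> x) \<one>\<^bsub>G\<^esub>"
proof -
  let ?z = "inv\<^bsub>G\<^esub> y \<otimes>\<^bsub>G\<^esub> x"
  have "walk_pos N x t \<omega> = y \<longleftrightarrow> walk_pos N ?z t \<omega> = \<one>\<^bsub>G\<^esub>" if \<omega>: "\<omega> \<in> space (walk_space N r)" for \<omega>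
  proof -
    have "fst \<omega> i \<in> carrier G" for i
      using \<omega> by (auto simp: walk_space_eq space_pair_measure steps_in_carrier)
    then have c: "finprod G (fst \<omega>) {..<num_jumps (snd \<omega>) t} \<in> carrier G"
      by (intro G.finprod_closed) auto
    have "walk_pos N ?z t \<omega> = inv\<^bsub>G\<^esub> y \<otimes>\<^bsub>G\<^esub> walk_pos N x t \<omega>"
      using x y c by (simp add: walk_pos_def G.m_assoc)
    then show ?thesis
      using y walk_pos_in_carrier[OF x \<omega>] by (metis G.inv_closed G.inv_equality G.inv_inv G.l_inv)
  qed
  then show ?thesis
    unfolding trans_prob_def by (intro arg_cong[where f = "measure _"]) auto
qed

end

section \<open>Finiteness of the fractional potentials\<close>

text \<open>Euler's integral for \<open>Gamma \<zeta>\<close> after the substitution of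
  \<open>h * t\<close> for \<open>t\<close>.\<close>

lemma nn_integral_powr_exp:
  fixes \<zeta> h :: real
  assumes \<zeta>: "\<zeta> > 0" and h: "h > 0"
  shows "(\<integral>\<^sup>+t\<in>{0<..}. ennreal (t powr (\<zeta> - 1) * exp (- t * h)) \<partial>lborel)
    = ennreal (Gamma \<zeta> * h powr (- \<zeta>))"
proof -
  let ?I = "\<integral>\<^sup>+t\<in>{0<..}. ennreal (t powr (\<zeta> - 1) * exp (- t * h)) \<partial>lborel"
  let ?f = "\<lambda>t::real. ennreal (indicator {0..} t * t powr (\<zeta> - 1) / exp t)"
  have "ennreal (Gamma \<zeta>) = integral\<^sup>N lborel ?f"
    using Gamma_conv_nn_integral_real[OF \<zeta>] by simp
  also have "\<dots> = ennreal h * (\<integral>\<^sup>+t. ?f (0 + h * t) \<partial>lborel)"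
    using h by (subst nn_integral_real_affine[where c = h and t = 0]) auto
  also have "(\<integral>\<^sup>+t. ?f (0 + h * t) \<partial>lborel)
      = (\<integral>\<^sup>+t. ennreal (h powr (\<zeta> - 1)) * (ennreal (t powr (\<zeta> - 1) * exp (- t * h)) * indicator {0<..} t) \<partial>lborel)"
  proof (rule nn_integral_cong)
    fix t :: real
    \<comment> \<open>At \<open>t = 0\<close> the two indicators differ, but the left side vanishes
      as well because \<open>0 powr (\<zeta> - 1) = 0\<close>.\<close>
    show "?f (0 + h * t)
        = ennreal (h powr (\<zeta> - 1)) * (ennreal (t powr (\<zeta> - 1) * exp (- t * h)) * indicator {0<..} t)"
      using h by (cases t "0 :: real" rule: linorder_cases)
        (auto simp: ennreal_mult[symmetric] powr_mult exp_minus field_simps zero_le_mult_iff)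
  qed
  also have "\<dots> = ennreal (h powr (\<zeta> - 1)) * ?I"
    by (rule nn_integral_cmult) simp
  also have "ennreal h * (ennreal (h powr (\<zeta> - 1)) * ?I) = ennreal (h powr \<zeta>) * ?I"
    using h by (simp add: mult.assoc[symmetric] ennreal_mult[symmetric] powr_mult_base)
  \<comment> \<open>Multiplying by \<open>h powr (- \<zeta>)\<close> isolates \<open>?I\<close>
    without a cancellation in \<open>ennreal\<close>, where \<open>?I\<close> is not yet known to be
    finite.\<close>
  finally have "ennreal (h powr (- \<zeta>)) * ennreal (Gamma \<zeta>)
      = ennreal (h powr (- \<zeta>)) * (ennreal (h powr \<zeta>) * ?I)" by simp
  also have "\<dots> = ?I"
    using h by (simp add: mult.assoc[symmetric] ennreal_mult[symmetric] powr_add[symmetric])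
  finally show ?thesis
    using Gamma_real_pos[OF \<zeta>] by (simp add: ennreal_mult[symmetric] mult.commute)
qed

context hierarchical_walk
begin

definition potential_term :: "real \<Rightarrow> nat \<Rightarrow> real" where
  "potential_term \<zeta> k = rate k powr (- \<zeta>) / real N ^ k"

lemma potential_term_nonneg: "0 \<le> potential_term \<zeta> k"
  by (simp add: potential_term_def)

text \<open>Tonelli, term by term. The factor \<open>c\<close> will be \<open>1 - 1 / real N\<close>
  for necessity and the total mass of \<open>\<phi>\<close> for sufficiency.\<close>

lemma nn_integral_exp_series:
  assumes \<zeta>: "\<zeta> > 0" and c: "c \<ge> 0"
  shows "(\<integral>\<^sup>+t\<in>{0<..}. ennreal (t powr (\<zeta> - 1)) * (\<Sum>k. ennreal (c * exp (- t * rate k) / real N ^ k)) \<partial>lborel)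
    = ennreal (Gamma \<zeta>) * (\<Sum>k. ennreal (c * potential_term \<zeta> k))"
proof -
  have "(\<integral>\<^sup>+t\<in>{0<..}. ennreal (t powr (\<zeta> - 1)) * (\<Sum>k. ennreal (c * exp (- t * rate k) / real N ^ k)) \<partial>lborel)
    = (\<integral>\<^sup>+t. (\<Sum>k. ennreal (c / real N ^ k) *
        (ennreal (t powr (\<zeta> - 1) * exp (- t * rate k)) * indicator {0<..} t)) \<partial>lborel)"
  proof (rule nn_integral_cong)
    fix t :: real
    have "ennreal (t powr (\<zeta> - 1)) * (\<Sum>k. ennreal (c * exp (- t * rate k) / real N ^ k))
      = (\<Sum>k. ennreal (t powr (\<zeta> - 1)) * ennreal (c * exp (- t * rate k) / real N ^ k))"
      by (rule ennreal_suminf_cmult[symmetric])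
    also have "\<dots> = (\<Sum>k. ennreal (c / real N ^ k) * ennreal (t powr (\<zeta> - 1) * exp (- t * rate k)))"
      using c by (intro suminf_cong) (simp add: ennreal_mult[symmetric] mult_ac)
    finally show "ennreal (t powr (\<zeta> - 1)) * (\<Sum>k. ennreal (c * exp (- t * rate k) / real N ^ k))
        * indicator {0<..} t
      = (\<Sum>k. ennreal (c / real N ^ k) *
        (ennreal (t powr (\<zeta> - 1) * exp (- t * rate k)) * indicator {0<..} t))"
      by (cases "t > 0") auto
  qed
  also have "\<dots> = (\<Sum>k. ennreal (c / real N ^ k) * ennreal (Gamma \<zeta> * rate k powr (- \<zeta>)))"
    using nn_integral_powr_exp[OF \<zeta> rate_pos]
    by (subst nn_integral_suminf) (simp_all add: nn_integral_cmult)
  also have "\<dots> = (\<Sum>k. ennreal (Gamma \<zeta>) * ennreal (c * potential_term \<zeta> k))"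
    using c Gamma_real_pos[OF \<zeta>]
    by (intro suminf_cong) (simp add: ennreal_mult[symmetric] potential_term_def mult_ac)
  finally show ?thesis by simp
qed

lemma summable_exp_series:
  assumes "t \<ge> 0"
  shows "summable (\<lambda>k. exp (- t * rate k) / real N ^ k)"
proof (rule summable_comparison_test')
  show "summable (\<lambda>k. (1 / real N) ^ k)"
    using N by (intro summable_geometric) auto
  fix k
  have "exp (- t * rate k) \<le> 1"
    using assms rate_pos[of k] by simp
  then show "norm (exp (- t * rate k) / real N ^ k) \<le> (1 / real N) ^ k"
    by (simp add: power_one_over divide_right_mono)
qed

text \<open>Bounding \<open>eigfun\<close> by 1 yields a majorant that is independent of both
  endpoints.\<close>

lemma trans_prob_le:
  assumes "x \<in> carrier G" "y \<in> carrier G" "t > 0"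
  shows "trans_prob N r t x y \<le> (\<Sum>k. exp (- t * rate k) / real N ^ k)"
proof -
  let ?z = "inv\<^bsub>G\<^esub> y \<otimes>\<^bsub>G\<^esub> x"
  have 1: "(\<lambda>k. exp (- t * rate k) * eigfun k ?z / real N ^ k) sums trans_prob N r t x y"
    using assms by (simp only: trans_prob_translate[OF assms(1,2)]) (rule trans_prob_one_sums, auto)
  have 2: "(\<lambda>k. exp (- t * rate k) / real N ^ k) sums (\<Sum>k. exp (- t * rate k) / real N ^ k)"
    using assms by (intro summable_sums summable_exp_series) simp
  have 3: "exp (- t * rate k) * eigfun k ?z / real N ^ k \<le> exp (- t * rate k) / real N ^ k" for k
  proof -
    have "eigfun k ?z \<le> 1" using abs_eigfun_le_1[of k ?z] by linarith
    then have "exp (- t * rate k) * eigfun k ?z \<le> exp (- t * rate k) * 1"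
      by (intro mult_left_mono) auto
    then show ?thesis by (intro divide_right_mono) auto
  qed
  show ?thesis by (rule sums_le[OF 3 1 2])
qed

lemma semigroup_op_finite_support:
  assumes "finite A" "A \<subseteq> carrier G" "\<And>y. y \<in> carrier G - A \<Longrightarrow> \<phi> y = 0"
  shows "semigroup_op N r t \<phi> x = (\<Sum>y\<in>A. trans_prob N r t x y * \<phi> y)"
proof -
  have "semigroup_op N r t \<phi> x = infsum (\<lambda>y. trans_prob N r t x y * \<phi> y) A"
    unfolding semigroup_op_def using assms by (intro infsum_cong_neutral) auto
  then show ?thesis using assms(1) by simp
qed

text \<open>Tested on the indicator of the identity, started there. All eigenfunctions have the same
  positive value \<open>1 - 1 / real N\<close> at this point, so the potential is a positive
  multiple of the series.\<close>

lemma potential_finite_imp_summable: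
  assumes \<zeta>: "\<zeta> > 0" and fin: "potential_finite N r \<zeta>"
  shows "summable (potential_term \<zeta>)"
proof -
  let ?o = "\<one>\<^bsub>G\<^esub>" and ?c = "1 - 1 / real N"
  let ?\<phi> = "indicator {?o} :: (nat \<Rightarrow> int) \<Rightarrow> real"
  have c: "?c > 0" using N by simp
  have "frac_potential N r \<zeta> ?\<phi> ?o < \<infinity>"
  proof -
    have "finite {y \<in> carrier G. ?\<phi> y \<noteq> 0}"
      by (rule finite_subset[of _ "{?o}"]) (auto simp: indicator_def)
    then show ?thesis
      using fin unfolding potential_finite_def by (elim allE[of _ ?\<phi>]) auto
  qed
  moreover have "frac_potential N r \<zeta> ?\<phi> ?o
      = ennreal (1 / Gamma \<zeta>) * (ennreal (Gamma \<zeta>) * (\<Sum>k. ennreal (?c * potential_term \<zeta> k)))"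
  proof -
    have "(\<integral>\<^sup>+t\<in>{0<..}. ennreal (t powr (\<zeta> - 1) * semigroup_op N r t ?\<phi> ?o) \<partial>lborel)
      = (\<integral>\<^sup>+t\<in>{0<..}. ennreal (t powr (\<zeta> - 1)) * (\<Sum>k. ennreal (?c * exp (- t * rate k) / real N ^ k)) \<partial>lborel)"
    proof (rule nn_integral_cong)
      fix t :: real
      show "ennreal (t powr (\<zeta> - 1) * semigroup_op N r t ?\<phi> ?o) * indicator {0<..} t
        = ennreal (t powr (\<zeta> - 1)) * (\<Sum>k. ennreal (?c * exp (- t * rate k) / real N ^ k)) * indicator {0<..} t"
      proof (cases "t > 0")
        case True
        have "(\<lambda>k. ?c * exp (- t * rate k) / real N ^ k) sums trans_prob N r t ?o ?o"
          using trans_prob_one_sums[OF G.one_closed True] by (simp add: eigfun_one mult.commute)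
        moreover have "semigroup_op N r t ?\<phi> ?o = trans_prob N r t ?o ?o"
          by (subst semigroup_op_finite_support[where A = "{?o}"]) auto
        ultimately have "(\<Sum>k. ennreal (?c * exp (- t * rate k) / real N ^ k)) = ennreal (semigroup_op N r t ?\<phi> ?o)"
          using c by (intro suminf_ennreal_eq) auto
        moreover have "semigroup_op N r t ?\<phi> ?o \<ge> 0"
          by (simp add: \<open>semigroup_op N r t ?\<phi> ?o = trans_prob N r t ?o ?o\<close> trans_prob_def)
        ultimately show ?thesis by (simp add: ennreal_mult)
      qed simp
    qed
    then show ?thesis
      using c by (simp only: frac_potential_def nn_integral_exp_series[OF \<zeta> less_imp_le])
  qed
  ultimately have "(\<Sum>k. ennreal (?c * potential_term \<zeta> k)) \<noteq> \<top>"
    using Gamma_real_pos[OF \<zeta>] by (auto simp: ennreal_mult_top)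
  then have "summable (\<lambda>k. ?c * potential_term \<zeta> k)"
    using c potential_term_nonneg by (intro summable_suminf_not_top) (auto intro: mult_nonneg_nonneg)
  then show ?thesis using c N by (auto simp: summable_cmult_iff)
qed

text \<open>By \<open>trans_prob_le\<close> the potential of \<open>\<phi>\<close> at any point is
  at most the total mass of \<open>\<phi>\<close> times the series of
  \<open>potential_term\<close>.\<close>

lemma summable_imp_potential_finite:
  assumes \<zeta>: "\<zeta> > 0" and sm: "summable (potential_term \<zeta>)"
  shows "potential_finite N r \<zeta>"
  unfolding potential_finite_def
proof (intro allI impI ballI)
  fix \<phi> :: "(nat \<Rightarrow> int) \<Rightarrow> real" and x
  assume "(\<forall>y\<in>carrier G. 0 \<le> \<phi> y) \<and> finite {y \<in> carrier G. \<phi> y \<noteq> 0}"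
  then have nn: "\<And>y. y \<in> carrier G \<Longrightarrow> 0 \<le> \<phi> y" and fin: "finite {y \<in> carrier G. \<phi> y \<noteq> 0}"
    by auto
  assume x: "x \<in> carrier G"
  let ?A = "{y \<in> carrier G. \<phi> y \<noteq> 0}"
  define c where "c = sum \<phi> ?A"
  have c: "c \<ge> 0" unfolding c_def using nn by (intro sum_nonneg) auto
  have "(\<integral>\<^sup>+t\<in>{0<..}. ennreal (t powr (\<zeta> - 1) * semigroup_op N r t \<phi> x) \<partial>lborel)
      \<le> (\<integral>\<^sup>+t\<in>{0<..}. ennreal (t powr (\<zeta> - 1)) * (\<Sum>k. ennreal (c * exp (- t * rate k) / real N ^ k)) \<partial>lborel)"
  proof (rule nn_integral_mono)
    fix t :: real
    show "ennreal (t powr (\<zeta> - 1) * semigroup_op N r t \<phi> x) * indicator {0<..} t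
      \<le> ennreal (t powr (\<zeta> - 1)) * (\<Sum>k. ennreal (c * exp (- t * rate k) / real N ^ k)) * indicator {0<..} t"
    proof (cases "t > 0")
      case True
      let ?g = "\<Sum>k. exp (- t * rate k) / real N ^ k"
      have "semigroup_op N r t \<phi> x = (\<Sum>y\<in>?A. trans_prob N r t x y * \<phi> y)"
        using fin by (intro semigroup_op_finite_support) auto
      also have "\<dots> \<le> (\<Sum>y\<in>?A. ?g * \<phi> y)"
        using x True nn by (intro sum_mono mult_right_mono trans_prob_le) auto
      also have "\<dots> = c * ?g"
        unfolding c_def sum_distrib_right by (simp only: mult.commute)
      finally have "ennreal (t powr (\<zeta> - 1) * semigroup_op N r t \<phi> x) \<le> ennreal (t powr (\<zeta> - 1) * (c * ?g))"
        by (intro ennreal_leI mult_left_mono) auto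
      also have "\<dots> = ennreal (t powr (\<zeta> - 1)) * ennreal (c * ?g)"
        by (rule ennreal_mult') simp
      also have "ennreal (c * ?g) = (\<Sum>k. ennreal (c * exp (- t * rate k) / real N ^ k))"
        using True c sums_mult[OF summable_sums[OF summable_exp_series], of t c]
        by (intro suminf_ennreal_eq[symmetric]) auto
      finally show ?thesis using True by simp
    qed simp
  qed
  also have "\<dots> = ennreal (Gamma \<zeta>) * (\<Sum>k. ennreal (c * potential_term \<zeta> k))"
    by (rule nn_integral_exp_series[OF \<zeta> c])
  also have "\<dots> < \<top>"
  proof -
    have "(\<Sum>k. ennreal (c * potential_term \<zeta> k)) \<noteq> \<top>"
      using c potential_term_nonneg sm
      by (subst suminf_ennreal2) (auto intro: summable_mult)
    then show ?thesis by (simp add: ennreal_mult_less_top less_top)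
  qed
  finally show "frac_potential N r \<zeta> \<phi> x < \<infinity>"
    by (simp add: frac_potential_def ennreal_mult_less_top)
qed

lemma potential_finite_iff: "\<zeta> > 0 \<Longrightarrow> potential_finite N r \<zeta> \<longleftrightarrow> summable (potential_term \<zeta>)"
  using potential_finite_imp_summable summable_imp_potential_finite by blast

section \<open>Geometric weights and the critical order of the potential\<close>

lemma rate_lower: "r (Suc k) \<le> rate k"
proof -
  have s: "summable (\<lambda>j. r (Suc j))" using r_sums by (rule sums_summable)
  have "(\<Sum>i<Suc k. r (Suc i)) < 1"
    using sum_less_suminf[OF s, of "Suc k"] r_pos sums_unique[OF r_sums] by auto
  moreover have "0 \<le> r (Suc k) / (real N - 1)"
    using N r_pos[of k] by simp
  ultimately show ?thesis by (simp add: rate_def eigval_def)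
qed

text \<open>The tail of the weights from \<open>Suc k\<close> on is dominated by a geometric series,
  which gives \<open>C / (1 - q)\<close>; the second \<open>C\<close> covers the term
  \<open>r (Suc k) / (real N - 1)\<close>, where \<open>N - 1 \<ge> 1\<close>.\<close>

lemma rate_upper:
  assumes q: "0 < q" "q < 1" and C: "\<And>j. j \<ge> k \<Longrightarrow> r (Suc j) \<le> C * q ^ j"
  shows "rate k \<le> (C / (1 - q) + C) * q ^ k"
proof -
  have s: "summable (\<lambda>j. r (Suc j))" using r_sums by (rule sums_summable)
  have "(\<Sum>j. r (Suc (j + k))) \<le> (\<Sum>j. C * q ^ k * q ^ j)"
  proof (rule suminf_le)
    show "r (Suc (j + k)) \<le> C * q ^ k * q ^ j" for j
      using C[of "j + k"] by (simp add: power_add mult_ac)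
    show "summable (\<lambda>j. r (Suc (j + k)))"
      using summable_ignore_initial_segment[OF s, of k] by simp
    show "summable (\<lambda>j. C * q ^ k * q ^ j)"
      using q by (intro summable_mult summable_geometric) auto
  qed
  also have "\<dots> = C * q ^ k / (1 - q)"
    using q by (subst suminf_mult) (auto simp: suminf_geometric summable_geometric)
  finally have tail: "(\<Sum>j. r (Suc (j + k))) \<le> C * q ^ k / (1 - q)" .
  have "1 - (\<Sum>i<k. r (Suc i)) = (\<Sum>j. r (Suc (j + k)))"
    using suminf_split_initial_segment[OF s, of k] sums_unique[OF r_sums] by simp
  moreover have "r (Suc k) / (real N - 1) \<le> r (Suc k) / 1"
    using N r_pos[of k] by (intro divide_left_mono) auto
  ultimately have "rate k \<le> C * q ^ k / (1 - q) + C * q ^ k"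
    using tail C[of k] by (simp add: rate_def eigval_def)
  then show ?thesis by (simp add: algebra_simps)
qed

text \<open>Identifies the ratio \<open>q powr (- \<zeta>) / real N\<close>, whose comparison with 1
  decides about convergence.\<close>

lemma potential_term_geometric:
  assumes "C > 0" "q > 0"
  shows "(C * q ^ k) powr (- \<zeta>) / real N ^ k = C powr (- \<zeta>) * (q powr (- \<zeta>) / real N) ^ k"
  using assms
  by (simp add: powr_mult powr_realpow[symmetric] powr_powr power_divide mult_ac)

text \<open>With a ratio of at least 1 the terms stay above a positive constant, so they do not tend
  to 0. This includes the critical order itself, where the ratio equals 1.\<close>

lemma not_potential_finite:
  assumes q: "0 < q" "q < 1" and C: "C > 0" "\<forall>\<^sub>F k in sequentially. r (Suc k) \<le> C * q ^ k"
    and \<zeta>: "\<zeta> > 0" "real N \<le> q powr (- \<zeta>)"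
  shows "\<not> potential_finite N r \<zeta>"
proof
  assume "potential_finite N r \<zeta>"
  then have "potential_term \<zeta> \<longlonglongrightarrow> 0"
    using \<zeta> potential_finite_iff summable_LIMSEQ_zero by blast
  moreover define D where "D = C / (1 - q) + C"
  have D: "D > 0" using q C by (auto simp: D_def intro!: add_pos_pos divide_pos_pos)
  obtain k0 where k0: "\<And>k. k \<ge> k0 \<Longrightarrow> r (Suc k) \<le> C * q ^ k"
    using C(2) by (auto simp: eventually_sequentially)
  have "D powr (- \<zeta>) \<le> potential_term \<zeta> k" if k: "k \<ge> k0" for k
  proof -
    have "rate k \<le> D * q ^ k"
      unfolding D_def using k0 k q by (intro rate_upper) auto
    then have le: "(D * q ^ k) powr (- \<zeta>) \<le> rate k powr (- \<zeta>)"
      using rate_pos[of k] \<zeta> by (intro powr_mono2') auto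
    have "1 \<le> (q powr (- \<zeta>) / real N) ^ k"
      using \<zeta> N by (intro one_le_power) simp
    then have "D powr (- \<zeta>) * 1 \<le> D powr (- \<zeta>) * (q powr (- \<zeta>) / real N) ^ k"
      by (intro mult_left_mono) auto
    also have "\<dots> = (D * q ^ k) powr (- \<zeta>) / real N ^ k"
      using D q by (simp add: potential_term_geometric)
    also have "\<dots> \<le> potential_term \<zeta> k"
      unfolding potential_term_def using le by (intro divide_right_mono) auto
    finally show ?thesis by simp
  qed
  then have "D powr (- \<zeta>) \<le> 0" if "potential_term \<zeta> \<longlonglongrightarrow> 0"
    using that by (intro LIMSEQ_le_const) auto
  ultimately show False using D by simp
qed

text \<open>Comparison, through \<open>rate_lower\<close>, with a geometric series whose ratio is
  strictly below 1.\<close>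

lemma potential_finiteI:
  assumes q: "0 < q" and C: "C > 0" "\<forall>\<^sub>F k in sequentially. C * q ^ k \<le> r (Suc k)"
    and \<zeta>: "\<zeta> > 0" "q powr (- \<zeta>) < real N"
  shows "potential_finite N r \<zeta>"
proof -
  have "summable (potential_term \<zeta>)"
  proof (rule summable_comparison_test_ev)
    show "summable (\<lambda>k. C powr (- \<zeta>) * (q powr (- \<zeta>) / real N) ^ k)"
      using \<zeta> N by (intro summable_mult summable_geometric) simp
    show "\<forall>\<^sub>F k in sequentially.
        norm (potential_term \<zeta> k) \<le> C powr (- \<zeta>) * (q powr (- \<zeta>) / real N) ^ k"
      using C(2)
    proof eventually_elim
      case (elim k)
      then have "C * q ^ k \<le> rate k" using rate_lower[of k] by linarith
      then have "rate k powr (- \<zeta>) \<le> (C * q ^ k) powr (- \<zeta>)"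
        using C q \<zeta> by (intro powr_mono2') auto
      then have "potential_term \<zeta> k \<le> (C * q ^ k) powr (- \<zeta>) / real N ^ k"
        unfolding potential_term_def by (intro divide_right_mono) auto
      then show ?case
        using C q potential_term_nonneg[of \<zeta> k] by (simp add: potential_term_geometric)
    qed
  qed
  then show ?thesis using \<zeta> potential_finite_iff by blast
qed

end

section \<open>Bounds on the degree\<close>

lemma ratio_upper_imp_geometric:
  fixes c :: "nat \<Rightarrow> real"
  assumes "\<And>j. c j > 0" "a > 0" "\<forall>\<^sub>F j in sequentially. c (Suc j) / c j \<le> a"
  obtains C where "C > 0" "\<forall>\<^sub>F j in sequentially. c j \<le> C * a ^ j"
proof -
  obtain k where k: "\<And>j. j \<ge> k \<Longrightarrow> c (Suc j) / c j \<le> a"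
    using assms(3) by (auto simp: eventually_sequentially)
  \<comment> \<open>The constant \<open>c k / a ^ k\<close> gives equality at \<open>j = k\<close>;
    afterwards each index multiplies \<open>c\<close> by at most \<open>a\<close>.\<close>
  have "c j \<le> c k / a ^ k * a ^ j" if "j \<ge> k" for j
    using that
  proof (induction j rule: dec_induct)
    case (step j)
    have "c (Suc j) \<le> a * c j"
      using k[OF step(1)] assms(1)[of j] by (simp add: divide_le_eq)
    also have "\<dots> \<le> a * (c k / a ^ k * a ^ j)"
      using step assms(2) by (intro mult_left_mono) auto
    finally show ?case by (simp add: mult_ac)
  qed (use assms in simp)
  then show ?thesis
    using assms by (intro that[of "c k / a ^ k"]) (auto simp: eventually_sequentially)
qed

lemma ratio_lower_imp_geometric:
  fixes c :: "nat \<Rightarrow> real"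
  assumes "\<And>j. c j > 0" "a > 0" "\<forall>\<^sub>F j in sequentially. a \<le> c (Suc j) / c j"
  obtains C where "C > 0" "\<forall>\<^sub>F j in sequentially. C * a ^ j \<le> c j"
proof -
  obtain k where k: "\<And>j. j \<ge> k \<Longrightarrow> a \<le> c (Suc j) / c j"
    using assms(3) by (auto simp: eventually_sequentially)
  have "c k / a ^ k * a ^ j \<le> c j" if "j \<ge> k" for j
    using that
  proof (induction j rule: dec_induct)
    case (step j)
    have "a * (c k / a ^ k * a ^ j) \<le> a * c j"
      using step assms(2) by (intro mult_left_mono) auto
    also have "\<dots> \<le> c (Suc j)"
      using k[OF step(1)] assms(1)[of j] by (simp add: le_divide_eq)
    finally show ?case by (simp add: mult_ac)
  qed (use assms in simp)
  then show ?thesis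
    using assms by (intro that[of "c k / a ^ k"]) (auto simp: eventually_sequentially)
qed

text \<open>Turns the hypothesis comparing \<open>a\<close> with \<open>N powr (1 / \<mu>)\<close>
  into a geometric ratio below 1 for the jump weights.\<close>

lemma mult_powr_less_1:
  fixes a \<mu> :: real
  assumes "N \<ge> 2" "a < real N powr (1 / \<mu>)"
  shows "a * real N powr (- 1 / \<mu>) < 1"
proof -
  have "a * real N powr (- 1 / \<mu>) < real N powr (1 / \<mu>) * real N powr (- 1 / \<mu>)"
    using assms by (intro mult_strict_right_mono) auto
  also have "\<dots> = 1" using assms by (simp add: powr_add[symmetric])
  finally show ?thesis .
qed

text \<open>Here \<open>ln a\<close> occurs only once, which suits the comparison with the critical
  order and the limits in \<open>a\<close>.\<close>

lemma degree_bound_pos_eq: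
  assumes "a > 0" "\<mu> * ln a / ln (real N) < 1"
  shows "degree_bound \<mu> N a = \<mu> / (1 - \<mu> * ln a / ln (real N)) - 1"
proof -
  let ?x = "\<mu> * ln a / ln (real N)"
  have "(\<mu> - 1 + ?x) / (1 - ?x) = \<mu> / (1 - ?x) - (1 - ?x) / (1 - ?x)"
    by (simp only: diff_divide_distrib[symmetric]) simp
  also have "(1 - ?x) / (1 - ?x) = 1"
    by (rule divide_self) (use assms(2) in linarith)
  finally show ?thesis using assms(1) by (simp add: degree_bound_def)
qed

lemma ln_ratio_less_1:
  assumes "\<mu> > 0" "N \<ge> 2" "0 < a" "a < real N powr (1 / \<mu>)"
  shows "\<mu> * ln a / ln (real N) < 1"
proof -
  have "ln a < ln (real N powr (1 / \<mu>))"
    using assms by (subst ln_less_cancel_iff) auto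
  then have "\<mu> * ln a < ln (real N)"
    using assms by (simp add: ln_powr field_simps)
  then show ?thesis using assms by simp
qed

text \<open>Take logarithms: minus the logarithm of the ratio is
  \<open>(1 - \<mu> * ln a / ln N) * ln N / \<mu>\<close>, and the first factor is positive. The
  summand 1 reflects that degree \<open>\<zeta>\<close> concerns potentials of order
  \<open>\<zeta> + 1\<close>.\<close>

lemma degree_threshold:
  fixes \<mu> a \<zeta> :: real
  assumes "\<mu> > 0" "N \<ge> 2" "0 < a" "a < real N powr (1 / \<mu>)"
  shows "real N \<le> (a * real N powr (- 1 / \<mu>)) powr (- \<zeta>) \<longleftrightarrow> degree_bound \<mu> N a + 1 \<le> \<zeta>"
proof -
  let ?q = "a * real N powr (- 1 / \<mu>)"
  let ?x = "1 - \<mu> * ln a / ln (real N)"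
  have l: "ln (real N) > 0" using assms by simp
  have x: "?x > 0" using ln_ratio_less_1[OF assms] by simp
  have "real N \<le> ?q powr (- \<zeta>) \<longleftrightarrow> ln (real N) \<le> ln (?q powr (- \<zeta>))"
    using assms by (subst ln_le_cancel_iff) auto
  also have "ln (?q powr (- \<zeta>)) = - \<zeta> * (ln a - ln (real N) / \<mu>)"
    using assms by (simp add: ln_powr ln_mult)
  also have "\<dots> = \<zeta> * ?x * ln (real N) / \<mu>"
    using assms l by (simp add: field_simps)
  also have "ln (real N) \<le> \<zeta> * ?x * ln (real N) / \<mu> \<longleftrightarrow> \<mu> \<le> \<zeta> * ?x"
    using assms l by (simp add: pos_le_divide_eq mult.commute[of _ "ln (real N)"])
  also have "\<dots> \<longleftrightarrow> \<mu> / ?x \<le> \<zeta>"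
    using x by (simp only: pos_divide_le_eq)
  also have "\<dots> \<longleftrightarrow> degree_bound \<mu> N a + 1 \<le> \<zeta>"
    using assms ln_ratio_less_1[OF assms] by (simp add: degree_bound_pos_eq)
  finally show ?thesis .
qed

lemma degree_bound_gt_minus_1:
  assumes "\<mu> > 0" "N \<ge> 2" "0 < a" "a < real N powr (1 / \<mu>)"
  shows "degree_bound \<mu> N a > -1"
  using ln_ratio_less_1[OF assms] assms by (simp add: degree_bound_pos_eq)

locale stable_hierarchical_walk =
  fixes \<mu> :: real and c :: "nat \<Rightarrow> real" and N :: nat
  assumes mu: "\<mu> > 0" and c_pos: "\<And>j. c j > 0" and N: "N \<ge> 2"
    and summable_weight: "summable (raw_weight \<mu> c N)"
begin

sublocale hierarchical_walk N "jump_weight \<mu> c N"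
  using jump_weight_sums[OF c_pos N summable_weight] N by unfold_locales

definition total_weight :: real where
  "total_weight = (\<Sum>k. raw_weight \<mu> c N k)"

lemma total_weight_pos: "total_weight > 0"
  unfolding total_weight_def using summable_weight c_pos N
  by (intro suminf_pos) (auto simp: raw_weight_def)

lemma jump_weight_Suc:
  "jump_weight \<mu> c N (Suc k) = c k * (real N powr (- 1 / \<mu>)) ^ k / total_weight"
  using N by (simp add: jump_weight_def raw_weight_def total_weight_def powr_realpow[symmetric]
      powr_powr mult.commute)

text \<open>The jump weights are eventually at most a multiple of \<open>?q ^ k\<close>, so
  potentials are not finite from order \<open>degree_bound \<mu> N a + 1\<close> on.\<close>

lemma degree_le:
  assumes a: "0 < a" "a < real N powr (1 / \<mu>)"
    and ev: "\<forall>\<^sub>F j in sequentially. c (Suc j) / c j \<le> a"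
  shows "rw_degree \<mu> c N \<le> ereal (degree_bound \<mu> N a)"
proof -
  let ?q = "a * real N powr (- 1 / \<mu>)"
  obtain C where C: "C > 0" "\<forall>\<^sub>F j in sequentially. c j \<le> C * a ^ j"
    using ratio_upper_imp_geometric[OF c_pos a(1) ev] by blast
  have q: "0 < ?q" "?q < 1" using a N mult_powr_less_1[of N a \<mu>] by auto
  have "\<forall>\<^sub>F k in sequentially. jump_weight \<mu> c N (Suc k) \<le> C / total_weight * ?q ^ k"
    using C(2)
  proof eventually_elim
    case (elim k)
    then have "c k * (real N powr (- 1 / \<mu>)) ^ k \<le> C * a ^ k * (real N powr (- 1 / \<mu>)) ^ k"
      by (intro mult_right_mono) auto
    then have "c k * (real N powr (- 1 / \<mu>)) ^ k / total_weight
        \<le> C * a ^ k * (real N powr (- 1 / \<mu>)) ^ k / total_weight"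
      using total_weight_pos by (intro divide_right_mono) auto
    then show ?case by (simp add: jump_weight_Suc power_mult_distrib mult_ac)
  qed
  then have no: "\<not> potential_finite N (jump_weight \<mu> c N) \<zeta>"
    if "\<zeta> > 0" "degree_bound \<mu> N a + 1 \<le> \<zeta>" for \<zeta>
    using that q C(1) total_weight_pos degree_threshold[OF mu N a, of \<zeta>]
    by (intro not_potential_finite[where q = ?q and C = "C / total_weight"]) auto
  have "\<zeta> \<le> degree_bound \<mu> N a" if "\<zeta> > -1" "potential_finite N (jump_weight \<mu> c N) (\<zeta> + 1)" for \<zeta>
    using no[of "\<zeta> + 1"] that by fastforce
  \<comment> \<open>The bound exceeds -1, which takes care of the element inserted into the supremum
    in \<open>walk_degree\<close>.\<close>
  then show ?thesis
    unfolding rw_degree_def walk_degree_def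
    using degree_bound_gt_minus_1[OF mu N a]
    by (intro Sup_least) (auto simp: one_ereal_def)
qed

lemma degree_ge_minus_1: "-1 \<le> rw_degree \<mu> c N"
  unfolding rw_degree_def walk_degree_def by (rule Sup_upper) simp

lemma degree_ge:
  assumes a: "0 < a" "a < real N powr (1 / \<mu>)"
    and ev: "\<forall>\<^sub>F j in sequentially. a \<le> c (Suc j) / c j"
  shows "ereal (degree_bound \<mu> N a) \<le> rw_degree \<mu> c N"
proof -
  let ?q = "a * real N powr (- 1 / \<mu>)"
  obtain C where C: "C > 0" "\<forall>\<^sub>F j in sequentially. C * a ^ j \<le> c j"
    using ratio_lower_imp_geometric[OF c_pos a(1) ev] by blast
  have q: "0 < ?q" using a N by auto
  have "\<forall>\<^sub>F k in sequentially. C / total_weight * ?q ^ k \<le> jump_weight \<mu> c N (Suc k)"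
    using C(2)
  proof eventually_elim
    case (elim k)
    then have "C * a ^ k * (real N powr (- 1 / \<mu>)) ^ k \<le> c k * (real N powr (- 1 / \<mu>)) ^ k"
      by (intro mult_right_mono) auto
    then have "C * a ^ k * (real N powr (- 1 / \<mu>)) ^ k / total_weight
        \<le> c k * (real N powr (- 1 / \<mu>)) ^ k / total_weight"
      using total_weight_pos by (intro divide_right_mono) auto
    then show ?case by (simp add: jump_weight_Suc power_mult_distrib mult_ac)
  qed
  then have yes: "potential_finite N (jump_weight \<mu> c N) (\<zeta> + 1)"
    if "\<zeta> > -1" "\<zeta> < degree_bound \<mu> N a" for \<zeta>
    using that q C(1) total_weight_pos degree_threshold[OF mu N a, of "\<zeta> + 1"]
    by (intro potential_finiteI[where q = ?q and C = "C / total_weight"]) auto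
  \<comment> \<open>Finiteness is available only strictly below the bound, and
    \<open>\<zeta> > -1\<close> keeps the order positive. Density of the order on
    \<open>ereal\<close> then reaches the bound.\<close>
  have "\<zeta> \<le> rw_degree \<mu> c N" if \<zeta>: "-1 < \<zeta>" "\<zeta> < ereal (degree_bound \<mu> N a)" for \<zeta>
  proof -
    obtain z where z: "\<zeta> = ereal z" using \<zeta> by (cases \<zeta>) auto
    have "ereal z \<in> ereal ` {\<zeta>. \<zeta> > -1 \<and> potential_finite N (jump_weight \<mu> c N) (\<zeta> + 1)}"
      using \<zeta> yes[of z] unfolding z by (auto simp: one_ereal_def)
    then show ?thesis
      unfolding z rw_degree_def walk_degree_def by (intro Sup_upper) auto
  qed
  moreover have "-1 < ereal (degree_bound \<mu> N a)"
    using degree_bound_gt_minus_1[OF mu N a] by (simp add: one_ereal_def)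
  ultimately show ?thesis by (rule dense_le_bounded[rotated])
qed

end

section \<open>One-sided continuity of the bound and passage to the limsup and liminf\<close>

lemma degree_bound_tendsto_at_right:
  assumes "\<mu> > 0" "N \<ge> 2" "0 \<le> a" "a < real N powr (1 / \<mu>)"
  shows "(degree_bound \<mu> N \<longlongrightarrow> degree_bound \<mu> N a) (at_right a)"
proof -
  have ev: "\<forall>\<^sub>F b in at_right a. degree_bound \<mu> N b = \<mu> / (1 - \<mu> * ln b / ln (real N)) - 1"
    using eventually_at_right_less[of a] eventually_at_right_real[OF assms(4)]
  proof eventually_elim
    case (elim b)
    with assms show ?case by (intro degree_bound_pos_eq ln_ratio_less_1) auto
  qed
  show ?thesis
  proof (cases "a = 0")
    \<comment> \<open>As \<open>b\<close> decreases to 0, the denominator tends to infinity and the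
      bound to -1, the value that \<open>degree_bound\<close> assigns to
      \<open>a = 0\<close>.\<close>
    case True
    have "filterlim (\<lambda>b::real. \<mu> / ln (real N) * ln b) at_bot (at_right 0)"
      using assms by (intro filterlim_tendsto_pos_mult_at_bot[OF tendsto_const _ ln_at_0]) simp
    then have "filterlim (\<lambda>b::real. 1 + - (\<mu> / ln (real N) * ln b)) at_top (at_right 0)"
      by (intro filterlim_tendsto_add_at_top[OF tendsto_const])
        (simp only: filterlim_uminus_at_bot)
    then have "((\<lambda>b::real. \<mu> / (1 + - (\<mu> / ln (real N) * ln b)) - 1) \<longlongrightarrow> 0 - 1) (at_right 0)"
      by (intro tendsto_diff tendsto_const tendsto_divide_0[OF tendsto_const]
          filterlim_at_top_imp_at_infinity)
    then have "((\<lambda>b::real. \<mu> / (1 - \<mu> * ln b / ln (real N)) - 1) \<longlongrightarrow> degree_bound \<mu> N a) (at_right a)"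
      using True by (simp add: degree_bound_def)
    then show ?thesis
      by (rule tendsto_cong[THEN iffD1, rotated]) (use ev in \<open>eventually_elim, simp\<close>)
  next
    case False
    with assms have a: "a > 0" by simp
    have "((\<lambda>b::real. \<mu> / (1 - \<mu> * ln b / ln (real N)) - 1)
        \<longlongrightarrow> \<mu> / (1 - \<mu> * ln a / ln (real N)) - 1) (at_right a)"
      using a assms ln_ratio_less_1[OF assms(1,2) a assms(4)]
      by (intro tendsto_intros tendsto_divide) auto
    also have "\<mu> / (1 - \<mu> * ln a / ln (real N)) - 1 = degree_bound \<mu> N a"
      using degree_bound_pos_eq[OF a] ln_ratio_less_1[OF assms(1,2) a assms(4)] by simp
    finally show ?thesis
      by (rule tendsto_cong[THEN iffD1, rotated]) (use ev in \<open>eventually_elim, simp\<close>)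
  qed
qed

lemma degree_bound_tendsto_at_left:
  assumes "\<mu> > 0" "N \<ge> 2" "0 < a" "a < real N powr (1 / \<mu>)"
  shows "(degree_bound \<mu> N \<longlongrightarrow> degree_bound \<mu> N a) (at_left a)"
proof -
  have ev: "\<forall>\<^sub>F b in at_left a. degree_bound \<mu> N b = \<mu> / (1 - \<mu> * ln b / ln (real N)) - 1"
    using eventually_at_left_real[OF assms(3)]
  proof eventually_elim
    case (elim b)
    with assms show ?case by (intro degree_bound_pos_eq ln_ratio_less_1) auto
  qed
  have "((\<lambda>b::real. \<mu> / (1 - \<mu> * ln b / ln (real N)) - 1)
      \<longlongrightarrow> \<mu> / (1 - \<mu> * ln a / ln (real N)) - 1) (at_left a)"
    using assms ln_ratio_less_1[OF assms]
    by (intro tendsto_intros tendsto_divide) auto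
  also have "\<mu> / (1 - \<mu> * ln a / ln (real N)) - 1 = degree_bound \<mu> N a"
    using degree_bound_pos_eq assms ln_ratio_less_1[OF assms] by simp
  finally show ?thesis
    by (rule tendsto_cong[THEN iffD1, rotated]) (use ev in \<open>eventually_elim, simp\<close>)
qed

context stable_hierarchical_walk
begin

text \<open>Each \<open>a\<close> above the limsup eventually bounds the ratios, whereas the limsup
  itself need not. So \<open>degree_le\<close> is applied to such \<open>a\<close>, which then
  decreases to \<open>u\<close>.\<close>

lemma degree_le_limsup:
  assumes lim: "limsup (\<lambda>j. ereal (c (Suc j) / c j)) = ereal u" and u: "u < real N powr (1 / \<mu>)"
  shows "rw_degree \<mu> c N \<le> ereal (degree_bound \<mu> N u)"
proof -
  have "0 \<le> limsup (\<lambda>j. ereal (c (Suc j) / c j))"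
    using c_pos by (intro le_Limsup) (auto intro!: always_eventually less_imp_le divide_pos_pos)
  then have u0: "0 \<le> u" by (simp add: lim)
  have "\<forall>\<^sub>F a in at_right u. rw_degree \<mu> c N \<le> ereal (degree_bound \<mu> N a)"
    using eventually_at_right_real[OF u]
  proof eventually_elim
    case (elim a)
    have "limsup (\<lambda>j. ereal (c (Suc j) / c j)) < ereal a"
      using elim lim by simp
    from Limsup_lessD[OF this] have "\<forall>\<^sub>F j in sequentially. c (Suc j) / c j \<le> a"
      by eventually_elim simp
    then show ?case using elim u0 by (intro degree_le) auto
  qed
  moreover have "((\<lambda>a. ereal (degree_bound \<mu> N a)) \<longlongrightarrow> ereal (degree_bound \<mu> N u)) (at_right u)"
    using degree_bound_tendsto_at_right[OF mu N u0 u] by (intro tendsto_intros) auto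
  ultimately show ?thesis
    by (intro tendsto_lowerbound[where F = "at_right u"]) auto
qed

lemma degree_ge_liminf:
  assumes lim: "liminf (\<lambda>j. ereal (c (Suc j) / c j)) = ereal l" and l: "l < real N powr (1 / \<mu>)"
  shows "ereal (degree_bound \<mu> N l) \<le> rw_degree \<mu> c N"
proof -
  have "0 \<le> liminf (\<lambda>j. ereal (c (Suc j) / c j))"
    using c_pos by (intro Liminf_bounded) (auto intro!: always_eventually less_imp_le divide_pos_pos)
  then have l0: "0 \<le> l" by (simp add: lim)
  show ?thesis
  proof (cases "l = 0")
    \<comment> \<open>No positive \<open>a\<close> lies below \<open>l = 0\<close>, but there the
      bound is -1 and holds by convention.\<close>
    case True
    then show ?thesis using degree_ge_minus_1 by (simp add: degree_bound_def one_ereal_def)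
  next
    case False
    with l0 have pos: "0 < l" by simp
    have "\<forall>\<^sub>F a in at_left l. ereal (degree_bound \<mu> N a) \<le> rw_degree \<mu> c N"
      using eventually_at_left_real[OF pos]
    proof eventually_elim
      case (elim a)
      have "ereal a < liminf (\<lambda>j. ereal (c (Suc j) / c j))"
        using elim lim by simp
      from less_LiminfD[OF this] have "\<forall>\<^sub>F j in sequentially. a \<le> c (Suc j) / c j"
        by eventually_elim simp
      then show ?case using elim l by (intro degree_ge) auto
    qed
    moreover have "((\<lambda>a. ereal (degree_bound \<mu> N a)) \<longlongrightarrow> ereal (degree_bound \<mu> N l)) (at_left l)"
      using degree_bound_tendsto_at_left[OF mu N pos l] by (intro tendsto_intros) auto
    ultimately show ?thesis
      by (intro tendsto_upperbound[where F = "at_left l"]) auto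
  qed
qed

end

section \<open>Asymptotics for large \<open>N\<close>\<close>

lemma eventually_less_powr:
  fixes a \<mu> :: real
  assumes "\<mu> > 0"
  shows "\<forall>\<^sub>F N in sequentially. a < real N powr (1 / \<mu>)"
proof -
  have "filterlim (\<lambda>N. real N powr (1 / \<mu>)) at_top sequentially"
    using assms by real_asymp
  then show ?thesis by (simp add: filterlim_at_top_dense)
qed

text \<open>The asymptotic claim needs the walk to exist for all large \<open>N\<close>. The
  coefficients grow at most like \<open>a ^ j\<close>, so the weights are summable once
  \<open>N powr (1 / \<mu>)\<close> exceeds \<open>a\<close>.\<close>

lemma eventually_summable_raw_weight:
  assumes mu: "\<mu> > 0" and c: "\<And>j. c j > 0"
    and lim: "limsup (\<lambda>j. ereal (c (Suc j) / c j)) < ereal a" and a: "a > 0"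
  shows "\<forall>\<^sub>F N in sequentially. summable (raw_weight \<mu> c N)"
proof -
  have "\<forall>\<^sub>F j in sequentially. c (Suc j) / c j \<le> a"
    using Limsup_lessD[OF lim] by eventually_elim simp
  then obtain C where C: "C > 0" "\<forall>\<^sub>F j in sequentially. c j \<le> C * a ^ j"
    using ratio_upper_imp_geometric[of c, OF c a] by blast
  show ?thesis
    using eventually_less_powr[OF mu, of a] eventually_ge_at_top[of 2]
  proof eventually_elim
    case (elim N)
    let ?q = "a * real N powr (- 1 / \<mu>)"
    have q: "0 < ?q" "?q < 1" using a elim mult_powr_less_1[of N a \<mu>] by auto
    have w: "raw_weight \<mu> c N j = c j * (real N powr (- 1 / \<mu>)) ^ j" for j
      using elim by (simp add: raw_weight_def powr_realpow[symmetric] powr_powr mult.commute)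
    show ?case
    proof (rule summable_comparison_test_ev)
      show "summable (\<lambda>j. C * ?q ^ j)"
        using q by (intro summable_mult summable_geometric) auto
      show "\<forall>\<^sub>F j in sequentially. norm (raw_weight \<mu> c N j) \<le> C * ?q ^ j"
        using C(2)
      proof eventually_elim
        case (elim j)
        then have "c j * (real N powr (- 1 / \<mu>)) ^ j \<le> C * a ^ j * (real N powr (- 1 / \<mu>)) ^ j"
          by (intro mult_right_mono) auto
        then show ?case
          using c[of j] by (simp add: w abs_mult power_mult_distrib mult_ac)
      qed
    qed
  qed
qed

text \<open>With \<open>x = \<mu> * ln a / ln N\<close> the difference equals
  \<open>\<mu> * x / (1 - x)\<close>, and \<open>x\<close> is a constant times
  \<open>1 / ln N\<close>.\<close>

lemma degree_bound_bigo:
  assumes "\<mu> > 0" "a > 0"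
  shows "(\<lambda>N. degree_bound \<mu> N a - (\<mu> - 1)) \<in> O(\<lambda>N. 1 / ln (real N))"
proof -
  have "(\<lambda>N. (\<mu> - 1 + \<mu> * ln a / ln (real N)) / (1 - \<mu> * ln a / ln (real N)) - (\<mu> - 1))
      \<in> O(\<lambda>N. 1 / ln (real N))"
    by real_asymp
  then show ?thesis using assms by (simp add: degree_bound_def)
qed

theorem proposition3p2p7:
  fixes \<mu> :: real and c :: "nat \<Rightarrow> real" and c_upper c_lower :: ereal
  assumes "\<mu> > 0"
    and "\<And>j. c j > 0"
    and "c_upper = limsup (\<lambda>j. ereal (c (Suc j) / c j))"
    and "c_lower = liminf (\<lambda>j. ereal (c (Suc j) / c j))"
  shows
    "(\<forall>N\<ge>2. summable (raw_weight \<mu> c N) \<longrightarrow> c_upper < ereal (real N powr (1 / \<mu>)) \<longrightarrow>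
        rw_degree \<mu> c N \<le> ereal (degree_bound \<mu> N (real_of_ereal c_upper))) \<and>
     (\<forall>N\<ge>2. summable (raw_weight \<mu> c N) \<longrightarrow> c_lower < ereal (real N powr (1 / \<mu>)) \<longrightarrow>
        rw_degree \<mu> c N \<ge> ereal (degree_bound \<mu> N (real_of_ereal c_lower))) \<and>
     (0 < c_lower \<and> c_lower \<le> c_upper \<and> c_upper < \<infinity> \<longrightarrow>
        (\<forall>\<^sub>F N in sequentially. \<bar>rw_degree \<mu> c N\<bar> \<noteq> \<infinity>) \<and>
        (\<lambda>N. real_of_ereal (rw_degree \<mu> c N) - (\<mu> - 1)) \<in> O(\<lambda>N. 1 / ln (real N)))"
proof -
  have walk: "stable_hierarchical_walk \<mu> c N" if "N \<ge> 2" "summable (raw_weight \<mu> c N)" for N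
    using assms(1,2) that by unfold_locales
  have lower0: "0 \<le> c_lower"
    unfolding assms(4) using assms(2)
    by (intro Liminf_bounded) (auto intro!: always_eventually less_imp_le divide_pos_pos)
  have le: "c_lower \<le> c_upper"
    unfolding assms(3,4) by (rule Liminf_le_Limsup) simp
  have upper: "rw_degree \<mu> c N \<le> ereal (degree_bound \<mu> N (real_of_ereal c_upper))"
    if hyps: "N \<ge> 2" "summable (raw_weight \<mu> c N)" "c_upper < ereal (real N powr (1 / \<mu>))" for N
  proof -
    interpret stable_hierarchical_walk \<mu> c N using hyps by (intro walk)
    \<comment> \<open>Being at least 0 and below a real number, \<open>c_upper\<close> is finite, so
      \<open>real_of_ereal\<close> keeps its value.\<close>
    obtain u where u: "c_upper = ereal u"
      using hyps(3) le lower0 by (cases c_upper) auto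
    show ?thesis
      using degree_le_limsup[of u] hyps(3) u assms(3) by simp
  qed
  have lower: "rw_degree \<mu> c N \<ge> ereal (degree_bound \<mu> N (real_of_ereal c_lower))"
    if hyps: "N \<ge> 2" "summable (raw_weight \<mu> c N)" "c_lower < ereal (real N powr (1 / \<mu>))" for N
  proof -
    interpret stable_hierarchical_walk \<mu> c N using hyps by (intro walk)
    obtain l where l: "c_lower = ereal l"
      using hyps(3) lower0 by (cases c_lower) auto
    show ?thesis
      using degree_ge_liminf[of l] hyps(3) l assms(4) by simp
  qed
  have "(\<forall>\<^sub>F N in sequentially. \<bar>rw_degree \<mu> c N\<bar> \<noteq> \<infinity>) \<and>
      (\<lambda>N. real_of_ereal (rw_degree \<mu> c N) - (\<mu> - 1)) \<in> O(\<lambda>N. 1 / ln (real N))"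
    if cl: "0 < c_lower" "c_upper < \<infinity>"
  proof -
    obtain u l where ul: "c_upper = ereal u" "c_lower = ereal l"
      using cl le by (cases c_upper; cases c_lower) auto
    have pos: "0 < l" "l \<le> u" using cl le ul by auto
    have "\<forall>\<^sub>F N in sequentially. summable (raw_weight \<mu> c N)"
    proof (rule eventually_summable_raw_weight[OF assms(1,2)])
      \<comment> \<open>Any positive real above the limsup would do in place of
        \<open>u + 1\<close>.\<close>
      show "limsup (\<lambda>j. ereal (c (Suc j) / c j)) < ereal (u + 1)"
        using assms(3) ul(1) by (simp flip: assms(3))
    qed (use pos in auto)
    then have ev: "\<forall>\<^sub>F N in sequentially. ereal (degree_bound \<mu> N l) \<le> rw_degree \<mu> c N
        \<and> rw_degree \<mu> c N \<le> ereal (degree_bound \<mu> N u)"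
      using eventually_less_powr[OF assms(1), of u] eventually_ge_at_top[of 2]
    proof eventually_elim
      \<comment> \<open>Once \<open>N powr (1 / \<mu>)\<close> exceeds \<open>u\<close> it exceeds
        \<open>l\<close> too, so both bounds apply.\<close>
      case (elim N)
      then show ?case using upper[of N] lower[of N] ul pos by simp
    qed
    then have fin: "\<forall>\<^sub>F N in sequentially. \<bar>rw_degree \<mu> c N\<bar> \<noteq> \<infinity>"
      by eventually_elim auto
    \<comment> \<open>The degree lies between the two bounds, so its distance from
      \<open>\<mu> - 1\<close> is at most the larger of their distances, hence at most the
      sum.\<close>
    have "(\<lambda>N. real_of_ereal (rw_degree \<mu> c N) - (\<mu> - 1))
        \<in> O(\<lambda>N. \<bar>degree_bound \<mu> N l - (\<mu> - 1)\<bar> + \<bar>degree_bound \<mu> N u - (\<mu> - 1)\<bar>)"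
    proof (rule bigoI[where c = 1])
      show "\<forall>\<^sub>F N in sequentially. norm (real_of_ereal (rw_degree \<mu> c N) - (\<mu> - 1))
          \<le> 1 * norm (\<bar>degree_bound \<mu> N l - (\<mu> - 1)\<bar> + \<bar>degree_bound \<mu> N u - (\<mu> - 1)\<bar>)"
        using ev
      proof eventually_elim
        case (elim N)
        then obtain d where "rw_degree \<mu> c N = ereal d" by (cases "rw_degree \<mu> c N") auto
        with elim have "degree_bound \<mu> N l \<le> d" "d \<le> degree_bound \<mu> N u"
          "real_of_ereal (rw_degree \<mu> c N) = d" by auto
        then show ?case by (auto simp: abs_if)
      qed
    qed
    also have "(\<lambda>N. \<bar>degree_bound \<mu> N l - (\<mu> - 1)\<bar> + \<bar>degree_bound \<mu> N u - (\<mu> - 1)\<bar>)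
        \<in> O(\<lambda>N. 1 / ln (real N))"
      using degree_bound_bigo[OF assms(1), of l] degree_bound_bigo[OF assms(1), of u] pos
      by (intro sum_in_bigo) auto
    finally show ?thesis using fin by blast
  qed
  with upper lower show ?thesis by blast
qed

end
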